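(* Let $f:\mathbb{R}\to\mathbb{R}$ be measurable. Then the following are equivalent: (a) $f\in \mathrm{BMO}^+$. (b) For every $0<s<t<1$, there exists $C>0$ such that, for all bounded open intervals $I\subset\mathbb{R}$, we have $$M_t(f,I^-)-M_s(f,I^+)\le C.$$ (c) There exist $0<s<t<1$ and $C>0$ such that the inequality $M_t(f,I^-)-M_s(f,I^+)\le C$ holds for all bounded open intervals $I\subset\mathbb{R}$.
   Context: Lebesgue measure on $\mathbb{R}$ is denoted $|\cdot|$. For a bounded open interval $I=(a,b)$, $a<b$: $I^-=(a,\frac{a+b}{2})$ and $I^+=(\frac{a+b}{2},b)$. Maximal median: for an interval $I$, a measurable $f:I\to\mathbb{R}$ and $0<s<1$, $M_s(f,I)=\sup\{\lambda\in\mathbb{R}:|\{x\in I:f(x)<\lambda\}|\le s|I|\}$. $f\in\mathrm{BMO}^+$ means that $f:\mathbb{R}\to\mathbb{R}$ is locally integrable and $$\sup_{I\subset\mathbb{R}}\frac{1}{|I^-|}\int_{I^-}(f-f_{I^+})^+<\infty,$$ where the supremum is over all bounded open intervals, $f_{I^+}=\frac{1}{|I^+|}\int_{I^+}f$, and $(g)^+=\max(g,0)$. *)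

theory Defs
  imports "HOL-Analysis.Analysis"
begin

text \<open>A bounded open interval \<open>I = (a, b)\<close> is given by its endpoints \<open>a < b\<close>.\<close>

definition left_half :: "real \<Rightarrow> real \<Rightarrow> real set" where
  "left_half a b = {a<..<(a + b) / 2}"

definition right_half :: "real \<Rightarrow> real \<Rightarrow> real set" where
  "right_half a b = {(a + b) / 2<..<b}"

text \<open>For measurable \<open>f\<close>, \<open>0 < s < 1\<close> and a nondegenerate bounded interval \<open>I\<close>, the set
  below is nonempty and bounded above, so the supremum in \<^typ>\<open>real\<close> is the true one.\<close>

definition max_median :: "real \<Rightarrow> (real \<Rightarrow> real) \<Rightarrow> real set \<Rightarrow> real" where
  "max_median s f I =
     Sup {l. measure lebesgue {x \<in> I. f x < l} \<le> s * measure lebesgue I}"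

definition locally_integrable :: "(real \<Rightarrow> real) \<Rightarrow> bool" where
  "locally_integrable f \<longleftrightarrow> (\<forall>K. compact K \<longrightarrow> set_integrable lebesgue K f)"

definition average :: "(real \<Rightarrow> real) \<Rightarrow> real set \<Rightarrow> real" where
  "average f I = (LINT x:I|lebesgue. f x) / measure lebesgue I"

text \<open>The supremum is taken in \<^typ>\<open>ereal\<close>, so that its finiteness is a genuine condition.\<close>

definition BMO_plus :: "(real \<Rightarrow> real) set" where
  "BMO_plus = {f. locally_integrable f \<and>
     (SUP (a, b) \<in> {(a, b). a < b}.
        ereal (average (\<lambda>x. max (f x - average f (right_half a b)) 0) (left_half a b))) < \<infinity>}"

end

theory Submission
  imports Defs
begin

text \<open>
  Both conditions are compared with a third one, \<open>splits_levels\<close>: every interval \<open>(a, b)\<close> and level \<open>\<mu>\<close>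
  admit a point \<open>p\<close> such that \<open>{f > \<mu> + l}\<close> occupies a small proportion \<open>\<phi> l\<close> of \<open>(a, p)\<close> and \<open>{f < \<mu> - l}\<close>
  a small proportion \<open>\<phi> l\<close> of \<open>(p, b)\<close>, for all \<open>l > 0\<close>.

  To find \<open>p\<close>, take a function \<open>g\<close> that is positive where \<open>f\<close> is small and let \<open>p\<close> be a point where the
  primitive of \<open>g\<close> is largest.  On either side of \<open>p\<close> the rising sun lemma produces an open set \<open>U\<close>
  that contains \<open>{g > 0}\<close> (on the right) or \<open>{g < 0}\<close> (on the left) up to a null set, and on each
  component \<open>(c, d)\<close> of \<open>U\<close> the mean of \<open>g\<close> is exactly 0 while all tails \<open>(x, d)\<close> have nonnegative mean.
  Cutting \<open>(c, d)\<close> by repeated halving towards \<open>d\<close> presents it as a union of left halves whose right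
  halves are tails; this is where a hypothesis that transfers information from right halves to
  left halves becomes a statement about \<open>U\<close>, hence about the whole of \<open>(a, p)\<close> or \<open>(p, b)\<close>
  (\<open>rising_sun_right\<close>, \<open>rising_sun_left\<close>, \<open>splitting_point\<close>).

  For \<open>f \<in> BMO_plus\<close> the choice \<open>g = \<mu> - f\<close> bounds the mean of \<open>\<bar>f - \<mu>\<bar>\<close> over \<open>U\<close>, and one obtains the decay
  \<open>\<phi> l = N / l\<close> (\<open>splits_levels_of_BMO_plus\<close>).  For the median condition with parameters \<open>s < t\<close> the choice
  \<open>g = 1\<^sub>E - s'\<close> with a sublevel set \<open>E\<close> of \<open>f\<close> and \<open>s < s' < t\<close> gives a geometric gain from one level to
  the next, hence exponential decay (\<open>splits_levels_of_median_gap\<close>).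

  Conversely, as soon as \<open>\<phi>\<close> tends to 0, a level midway between the median of the left half and that of
  the right half shows that the medians cannot be far apart, for any parameters \<open>s\<close> and \<open>t\<close>
  (\<open>median_gap_of_splits_levels\<close>).  If \<open>\<phi>\<close> decays exponentially, some level \<open>\<theta>\<close> is an upper bound on the
  left half and a lower bound on the right half up to exponentially small sets, and integration
  over levels gives \<open>BMO_plus\<close> (\<open>BMO_plus_of_splits_levels\<close>).
\<close>

section \<open>Components of a bounded open set\<close>

definition component_interval :: "real set \<Rightarrow> real \<Rightarrow> real \<Rightarrow> bool" where
  "component_interval U c d \<longleftrightarrow> c < d \<and> {c<..<d} \<subseteq> U \<and> c \<notin> U \<and> d \<notin> U"

lemma component_interval_bounds:
  assumes "component_interval U c d" "U \<subseteq> {a..b}"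
  shows "a \<le> c" "c < d" "d \<le> b"
proof -
  have "{c<..<d} \<subseteq> {a..b}" "c < d" using assms by (auto simp: component_interval_def)
  then show "a \<le> c" "c < d" "d \<le> b" by (auto simp: greaterThanLessThan_subseteq_atLeastAtMost_iff)
qed

lemma component_open_bounded_real:
  fixes U :: "real set"
  assumes "open U" "U \<subseteq> {a..b}" "K \<in> components U"
  obtains c d where "c < d" "K = {c<..<d}" "c \<notin> U" "d \<notin> U"
proof -
  have opK: "open K" by (rule open_components[OF assms(1,3)])
  have conn: "connected K" by (rule in_components_connected[OF assms(3)])
  have ne: "K \<noteq> {}" by (rule in_components_nonempty[OF assms(3)])
  have sub: "K \<subseteq> U" by (rule in_components_subset[OF assms(3)])
  have KI: "K \<subseteq> {a..b}" using sub assms(2) by (rule subset_trans)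
  have bel: "bdd_below K" by (rule bdd_below_mono[OF bdd_below_Icc KI])
  have abv: "bdd_above K" by (rule bdd_above_mono[OF bdd_above_Icc KI])
  define c d where "c = Inf K" and "d = Sup K"
  have in_K: "x \<in> K" if xU: "x \<in> U" and xK: "x \<in> closure K" for x
  proof -
    obtain e where e: "e > 0" "ball x e \<subseteq> U"
      by (rule openE[OF assms(1) xU])
    obtain y where "y \<in> K" "dist y x < e"
      using xK e(1) unfolding closure_approachable by blast
    then have "K \<inter> ball x e \<noteq> {}"
      by (auto simp: dist_commute)
    then have "ball x e \<subseteq> K"
      using components_maximal[OF assms(3) connected_ball e(2)] by blast
    then show ?thesis using e(1) by auto
  qed
  have cK: "c \<notin> K"
  proof
    assume "c \<in> K"
    then obtain e where e: "e > 0" "ball c e \<subseteq> K" by (rule openE[OF opK])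
    then have "c - e/2 \<in> K" by (simp add: dist_real_def subset_iff)
    then have "c \<le> c - e/2" unfolding c_def using bel by (rule cInf_lower)
    then show False using e(1) by simp
  qed
  have dK: "d \<notin> K"
  proof
    assume "d \<in> K"
    then obtain e where e: "e > 0" "ball d e \<subseteq> K" by (rule openE[OF opK])
    then have "d + e/2 \<in> K" by (simp add: dist_real_def subset_iff)
    then have "d + e/2 \<le> d" unfolding d_def using abv by (rule cSup_upper)
    then show False using e(1) by simp
  qed
  have Keq: "K = {c<..<d}"
  proof
    have "c \<le> x" "x \<le> d" if "x \<in> K" for x
      using that cInf_lower[OF _ bel] cSup_upper[OF _ abv] unfolding c_def d_def by auto
    then show "K \<subseteq> {c<..<d}"
      using cK dK by (metis greaterThanLessThan_iff less_le subsetI)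
    show "{c<..<d} \<subseteq> K"
    proof
      fix x assume x: "x \<in> {c<..<d}"
      obtain y where y: "y \<in> K" "y < x" using x cInf_lessD[OF ne, of x] c_def by auto
      obtain z where z: "z \<in> K" "x < z" using x less_cSupD[OF ne, of x] d_def by auto
      show "x \<in> K"
        using conn y z unfolding connected_iff_interval by (meson less_imp_le)
    qed
  qed
  have "c < d" using ne Keq by auto
  moreover have "c \<notin> U"
    using in_K[of c] cK closure_contains_Inf[OF ne bel] c_def by blast
  moreover have "d \<notin> U"
    using in_K[of d] dK closure_contains_Sup[OF ne abv] d_def by blast
  ultimately show ?thesis using Keq that by blast
qed

text \<open>
  An open set is the disjoint union of countably many component intervals, so a sign that the
  integral has on each of them survives summation.
\<close>
lemma set_integral_nonneg_by_components:
  fixes g :: "real \<Rightarrow> real"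
  assumes U: "open U" "U \<subseteq> {a..b}" and g: "set_integrable lebesgue U g"
    and comp: "\<And>c d. component_interval U c d \<Longrightarrow> 0 \<le> (LINT x:{c<..<d}|lebesgue. g x)"
  shows "0 \<le> (LINT x:U|lebesgue. g x)"
proof -
  let ?C = "components U"
  have opn: "open K" if "K \<in> ?C" for K
    using that U(1) open_components by blast
  have disj: "pairwise disjnt ?C"
    using pairwise_disjoint_components[of U] by (simp add: pairwise_def disjnt_def)
  have cnt: "countable ?C"
    using countable_disjoint_open_subsets[of ?C] opn disj by (auto simp: pairwise_def disjnt_def)
  \<comment> \<open>The components, enumerated by natural numbers and padded with the empty set.\<close>
  define A where "A n = (if n \<in> to_nat_on ?C ` ?C then from_nat_into ?C n else {})" for n
  have A_cases: "A n = {} \<or> A n \<in> ?C" for n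
    unfolding A_def using cnt by auto
  have Un: "(\<Union>n. A n) = U"
  proof
    show "(\<Union>n. A n) \<subseteq> U" using A_cases in_components_subset by fastforce
    show "U \<subseteq> (\<Union>n. A n)"
    proof
      fix x assume "x \<in> U"
      then obtain K where K: "K \<in> ?C" "x \<in> K" using Union_components[of U] by blast
      then have "A (to_nat_on ?C K) = K" unfolding A_def using cnt by auto
      then show "x \<in> (\<Union>n. A n)" using K by blast
    qed
  qed
  have meas: "A n \<in> sets lebesgue" for n
    using A_cases[of n] opn by auto
  have dis: "A i \<inter> A j = {}" if "i \<noteq> j" for i j
  proof (cases "A i = {} \<or> A j = {}")
    case False
    then have "i \<in> to_nat_on ?C ` ?C" "j \<in> to_nat_on ?C ` ?C" unfolding A_def by metis+
    then have "A i \<noteq> A j" "A i \<in> ?C" "A j \<in> ?C"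
      using that cnt unfolding A_def by auto
    then show ?thesis using disj by (auto simp: pairwise_def disjnt_def)
  qed auto
  have A_nonneg: "0 \<le> (LINT x:(A n)|lebesgue. g x)" for n
  proof (cases "A n = {}")
    case False
    then have K: "A n \<in> ?C" using A_cases by blast
    obtain c d where cd: "c < d" "A n = {c<..<d}" "c \<notin> U" "d \<notin> U"
      using component_open_bounded_real[OF U K] by blast
    have "A n \<subseteq> U" using K in_components_subset by blast
    then show ?thesis using comp[of c d] cd by (simp add: component_interval_def)
  qed (simp add: set_lebesgue_integral_def)
  have int_A: "set_integrable lebesgue (A n) g" for n
    using g by (rule set_integrable_subset) (use meas Un in auto)
  have "0 \<le> (LINT x:(\<Union>i\<le>n. A i)|lebesgue. g x)" for n
    using A_nonneg int_A meas dis
    by (subst set_integral_finite_Union) (auto simp: disjoint_family_on_def intro: sum_nonneg)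
  moreover have "(\<lambda>n. LINT x:(\<Union>i\<le>n. A i)|lebesgue. g x)
      \<longlonglongrightarrow> (LINT x:(\<Union>n. \<Union>i\<le>n. A i)|lebesgue. g x)"
  proof (rule set_integral_cont_up)
    have "(\<Union>n. \<Union>i\<le>n. A i) = U" using Un by auto
    then show "set_integrable lebesgue (\<Union>n. \<Union>i\<le>n. A i) g" using g by simp
    show "incseq (\<lambda>n. \<Union>i\<le>n. A i)" unfolding incseq_def
      by (meson UN_mono atMost_subset_iff order_refl)
    show "(\<Union>i\<le>n. A i) \<in> sets lebesgue" for n
      using meas by (intro sets.finite_UN) auto
  qed
  moreover have "(\<Union>n. \<Union>i\<le>n. A i) = U" using Un by auto
  ultimately show ?thesis by (intro LIMSEQ_le_const) auto
qed

section \<open>Integrals over intervals\<close>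

lemma set_integral_Ioo_eq_diff:
  fixes g :: "real \<Rightarrow> real"
  assumes g: "set_integrable lebesgue {a..b} g" and "a \<le> c" "c \<le> d" "d \<le> b"
  shows "(LINT x:{c<..<d}|lebesgue. g x) = integral {a..d} g - integral {a..c} g"
proof -
  have "set_integrable lebesgue {c<..<d} g"
    by (rule set_integrable_subset[OF g]) (use assms in auto)
  then have "(LINT x:{c<..<d}|lebesgue. g x) = integral {c<..<d} g"
    by (rule set_lebesgue_integral_eq_integral)
  also have "\<dots> = integral {c..d} g" using integral_open_interval[of c d g] by simp
  also have "\<dots> = integral {a..d} g - integral {a..c} g"
  proof -
    have "set_integrable lebesgue {a..d} g"
      by (rule set_integrable_subset[OF g]) (use assms in auto)
    then have "g integrable_on {a..d}" by (rule set_lebesgue_integral_eq_integral)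
    from Henstock_Kurzweil_Integration.integral_combine[OF assms(2,3) this] show ?thesis by simp
  qed
  finally show ?thesis .
qed

lemma continuous_on_integral_Icc:
  fixes g :: "real \<Rightarrow> real"
  assumes "set_integrable lebesgue {a..b} g"
  shows "continuous_on {a..b} (\<lambda>x. integral {a..x} g)"
  using assms by (intro indefinite_integral_continuous_1 set_lebesgue_integral_eq_integral)

text \<open>
  If \<open>g\<close> has nonnegative integral over the right half of an interval, then \<open>k\<close> has nonnegative
  integral over the left half.  This is the only form in which a one-sided hypothesis on \<open>f\<close>
  enters the covering argument: \<open>BMO_plus\<close> gives it for \<open>g = \<mu> - f\<close> and \<open>k = N - (f - \<mu>)\<^sup>+\<close>, the median
  condition for \<open>g = 1\<^sub>E - s'\<close> and \<open>k = 1\<^sub>F - t\<close> with sublevel sets \<open>E \<subseteq> F\<close>.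
\<close>
definition halving_implies :: "real \<Rightarrow> real \<Rightarrow> (real \<Rightarrow> real) \<Rightarrow> (real \<Rightarrow> real) \<Rightarrow> bool" where
  "halving_implies a b g k \<longleftrightarrow> (\<forall>x d. a \<le> x \<and> x < d \<and> d \<le> b \<and>
     0 \<le> (LINT y:{(x + d) / 2<..<d}|lebesgue. g y) \<longrightarrow> 0 \<le> (LINT y:{x<..<(x + d) / 2}|lebesgue. k y))"

text \<open>
  The points \<open>u n = d - (d - c) / 2^n\<close> cut \<open>(c, d)\<close> into a Whitney decomposition towards \<open>d\<close>.  Each
  piece \<open>(u n, u (n + 1))\<close> is the left half of \<open>(u n, d)\<close>, whose right half is a tail \<open>(u (n + 1), d)\<close>,
  so nonnegative tails of \<open>g\<close> make the integral of \<open>k\<close> over every piece nonnegative.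
\<close>
lemma set_integral_nonneg_by_halving:
  fixes g k :: "real \<Rightarrow> real"
  assumes k: "set_integrable lebesgue {c..d} k" and "c < d"
    and tail: "\<And>x. c < x \<Longrightarrow> x < d \<Longrightarrow> 0 \<le> (LINT y:{x<..<d}|lebesgue. g y)"
    and half: "halving_implies c d g k"
  shows "0 \<le> (LINT y:{c<..<d}|lebesgue. k y)"
proof -
  define u where "u n = d - (d - c) / 2 ^ n" for n :: nat
  have u_less: "u n < d" for n using \<open>c < d\<close> by (simp add: u_def)
  have u_ge: "c \<le> u n" for n
  proof -
    have "(d - c) / 2 ^ n \<le> d - c"
      using \<open>c < d\<close> by (simp add: divide_le_eq mult_le_cancel_left1)
    then show ?thesis by (simp add: u_def)
  qed
  have u_Suc: "u (Suc n) = (u n + d) / 2" for n by (simp add: u_def field_simps)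
  define F where "F x = integral {c..x} k" for x
  have "0 \<le> F (u n)" for n
  proof (induction n)
    case 0
    show ?case by (simp add: F_def u_def)
  next
    case (Suc n)
    have lt: "u n < u (Suc n)" using u_less[of n] by (simp add: u_Suc)
    have "0 \<le> (LINT y:{u n<..<u (Suc n)}|lebesgue. k y)"
      using half u_ge[of n] u_less[of n] u_less[of "Suc n"] lt tail[of "u (Suc n)"]
      unfolding halving_implies_def u_Suc by auto
    also have "\<dots> = F (u (Suc n)) - F (u n)"
      unfolding F_def using u_ge[of n] u_less[of "Suc n"] lt
      by (intro set_integral_Ioo_eq_diff[OF k]) auto
    finally show ?case using Suc by simp
  qed
  moreover have "(\<lambda>n. F (u n)) \<longlonglongrightarrow> F d"
  proof -
    have "u \<longlonglongrightarrow> d - 0" unfolding u_def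
      by (intro tendsto_intros LIMSEQ_divide_realpow_zero) auto
    then have ul: "u \<longlonglongrightarrow> d" by simp
    have c: "continuous_on {c..d} F"
      unfolding F_def by (rule continuous_on_integral_Icc[OF k])
    show ?thesis
      by (rule continuous_on_tendsto_compose[OF c ul])
         (use \<open>c < d\<close> u_ge u_less in \<open>auto simp: less_imp_le\<close>)
  qed
  ultimately have "0 \<le> F d" by (intro LIMSEQ_le_const) auto
  moreover have "(LINT y:{c<..<d}|lebesgue. k y) = F d - F c"
    unfolding F_def using \<open>c < d\<close> by (intro set_integral_Ioo_eq_diff[OF k]) auto
  ultimately show ?thesis by (simp add: F_def)
qed

text \<open>
  The part of Lebesgue's differentiation theorem behind the rising sun lemma.  If \<open>W\<close> is open and contains \<open>U\<close>,
  the endpoints of the components of \<open>W\<close> lie outside \<open>U\<close>, hence \<open>g\<close> has integral at most 0 over \<open>W\<close>.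
  Shrinking \<open>W\<close> to \<open>U \<union> S\<close>, where \<open>S\<close> is the part of \<open>{g > 0}\<close> outside \<open>U\<close>, gives the same bound
  over \<open>U \<union> S\<close>.  Since \<open>U\<close> itself contributes a nonnegative amount, the positive function \<open>g\<close> has
  integral at most 0 over \<open>S\<close>, so \<open>S\<close> is a null set.
\<close>
lemma AE_nonpos_outside_open:
  fixes g :: "real \<Rightarrow> real"
  assumes U: "open U" "U \<subseteq> {a<..<b}" and g: "set_integrable lebesgue {a..b} g"
    and zero: "\<And>c d. component_interval U c d \<Longrightarrow> 0 \<le> (LINT x:{c<..<d}|lebesgue. g x)"
    and neg: "\<And>c d. a \<le> c \<Longrightarrow> c < d \<Longrightarrow> d \<le> b \<Longrightarrow> c \<notin> U \<Longrightarrow> d \<notin> U \<Longrightarrow>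
                 (LINT x:{c<..<d}|lebesgue. g x) \<le> 0"
  shows "AE x in lebesgue. x \<in> {a<..<b} - U \<longrightarrow> g x \<le> 0"
proof -
  let ?I = "{a<..<b}"
  have sub: "set_integrable lebesgue V g" if "V \<in> sets lebesgue" "V \<subseteq> ?I" for V
    by (rule set_integrable_subset[OF g]) (use that in auto)
  have Um: "U \<in> sets lebesgue" using U by auto
  have gI: "set_integrable lebesgue ?I g" by (rule sub) auto
  define S where "S = {x \<in> ?I - U. 0 < g x}"
  have S: "S \<in> sets lebesgue"
  proof -
    have "(\<lambda>x. indicator ?I x *\<^sub>R g x) \<in> borel_measurable lebesgue"
      using gI unfolding set_integrable_def by auto
    then have "{x \<in> space lebesgue. 0 < indicator ?I x *\<^sub>R g x} \<in> sets lebesgue"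
      by measurable
    moreover have "S = {x \<in> space lebesgue. 0 < indicator ?I x *\<^sub>R g x} - U"
      by (auto simp: S_def indicator_def)
    ultimately show ?thesis using Um by auto
  qed
  have SU: "U \<union> S \<subseteq> ?I" using U(2) unfolding S_def by blast
  have W: "(LINT x:W|lebesgue. g x) \<le> 0" if "open W" "U \<subseteq> W" "W \<subseteq> ?I" for W
  proof -
    have "W \<subseteq> {a..b}" using that(3) by force
    have Wi: "set_integrable lebesgue W g" using that by (intro sub) auto
    have "0 \<le> (LINT x:W|lebesgue. - g x)"
    proof (rule set_integral_nonneg_by_components[OF \<open>open W\<close>])
      show "W \<subseteq> {a..b}" by fact
      show "set_integrable lebesgue W (\<lambda>x. - g x)" using Wi by (simp add: set_integrable_def)
      fix c d :: real assume cd: "component_interval W c d"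
      have "a \<le> c" "c < d" "d \<le> b"
        using component_interval_bounds[OF cd \<open>W \<subseteq> {a..b}\<close>] by auto
      then have "(LINT x:{c<..<d}|lebesgue. g x) \<le> 0"
        using neg cd that(2) unfolding component_interval_def by blast
      then show "0 \<le> (LINT x:{c<..<d}|lebesgue. - g x)"
        by (simp add: set_integral_uminus set_lebesgue_integral_def)
    qed
    then show ?thesis by (simp add: set_lebesgue_integral_def)
  qed
  have "\<exists>T. open T \<and> U \<union> S \<subseteq> T \<and> emeasure lebesgue (T - (U \<union> S)) < ennreal (1 / real (Suc n))" for n
    using sets_lebesgue_outer_open[of "U \<union> S" "1 / real (Suc n)"] S Um by (metis divide_pos_pos of_nat_0_less_iff sets.Un zero_less_Suc zero_less_one)
  then obtain T where T: "\<And>n. open (T n)" "\<And>n. U \<union> S \<subseteq> T n"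
      "\<And>n. emeasure lebesgue (T n - (U \<union> S)) < ennreal (1 / real (Suc n))" by metis
  define V where "V n = (\<Inter>i\<le>n. T i) \<inter> ?I" for n
  have V: "open (V n)" "U \<union> S \<subseteq> V n" "V n \<subseteq> ?I" "V n \<in> sets lebesgue" for n
    using T SU by (auto simp: V_def intro!: open_Int open_INT)
  have "decseq V" by (force simp: decseq_def V_def)
  then have "(\<lambda>n. LINT x:V n|lebesgue. g x) \<longlonglongrightarrow> (LINT x:(\<Inter>n. V n)|lebesgue. g x)"
    using V sub by (intro set_integral_cont_down) auto
  then have "(LINT x:(\<Inter>n. V n)|lebesgue. g x) \<le> 0"
    using W V by (intro LIMSEQ_le_const2) auto
  also have "(LINT x:(\<Inter>n. V n)|lebesgue. g x) = (LINT x:U \<union> S|lebesgue. g x)"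
  proof -
    let ?N = "(\<Inter>n. V n) - (U \<union> S)"
    have Nm: "?N \<in> sets lebesgue" using V S Um by auto
    have "emeasure lebesgue ?N \<le> ennreal (1 / real (Suc n))" for n
    proof -
      have "emeasure lebesgue ?N \<le> emeasure lebesgue (T n - (U \<union> S))"
        using T S Um by (intro emeasure_mono) (auto simp: V_def)
      then show ?thesis using T(3)[of n] by simp
    qed
    moreover have "(\<lambda>n. ennreal (1 / real (Suc n))) \<longlonglongrightarrow> ennreal 0"
      by (intro tendsto_ennrealI LIMSEQ_Suc lim_1_over_n)
    ultimately have "emeasure lebesgue ?N \<le> 0"
      by (intro LIMSEQ_le_const[where X = "\<lambda>n. ennreal (1 / real (Suc n))"]) auto
    then have "?N \<in> null_sets lebesgue" using Nm by (auto simp: null_sets_def)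
    then have "AE x in lebesgue. x \<notin> ?N" by (rule AE_not_in)
    then have "AE x in lebesgue. x \<in> U \<union> S \<longleftrightarrow> x \<in> (\<Inter>n. V n)"
      by eventually_elim (use V(2) in blast)
    moreover have "set_borel_measurable lebesgue A g" if "A \<in> sets lebesgue" "A \<subseteq> ?I" for A
      using sub[OF that] unfolding set_borel_measurable_def set_integrable_def
      by (rule borel_measurable_integrable)
    moreover have "(\<Inter>n. V n) \<in> sets lebesgue"
      using V(4) by (intro sets.countable_INT) auto
    moreover have "(\<Inter>n. V n) \<subseteq> ?I"
      using INT_lower[of 0 UNIV V] V(3)[of 0] by (meson UNIV_I subset_trans)
    ultimately show ?thesis
      using S Um SU by (intro set_integral_cong_set) auto
  qed
  also have "\<dots> = (LINT x:U|lebesgue. g x) + (LINT x:S|lebesgue. g x)"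
    using S Um SU by (intro set_integral_Un sub) (auto simp: S_def)
  finally have "(LINT x:U|lebesgue. g x) + (LINT x:S|lebesgue. g x) \<le> 0" .
  moreover have "0 \<le> (LINT x:U|lebesgue. g x)"
    using U Um zero by (intro set_integral_nonneg_by_components[of U a b] sub) force+
  moreover have "0 \<le> (LINT x:S|lebesgue. g x)"
    unfolding set_lebesgue_integral_def by (intro integral_nonneg_AE) (auto simp: S_def indicator_def)
  ultimately have "(LINT x:S|lebesgue. g x) = 0" by linarith
  then have "AE x in lebesgue. indicator S x *\<^sub>R g x = 0"
    using sub[OF S] SU unfolding set_lebesgue_integral_def set_integrable_def
    by (subst (asm) integral_nonneg_eq_0_iff_AE) (auto simp: S_def indicator_def)
  then show ?thesis by eventually_elim (auto simp: S_def indicator_def not_less split: if_splits)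
qed

section \<open>The rising sun lemma\<close>

text \<open>
  Riesz' rising sun lemma.  On a component \<open>(c, d)\<close> the maximum of \<open>G\<close> over \<open>[x, b]\<close> is not attained
  before \<open>d\<close>, and beyond \<open>d\<close> the function is at most \<open>G d\<close>; hence \<open>G x \<le> G d\<close>.  Because \<open>G\<close> is largest
  at the left endpoint \<open>p\<close>, even a component that starts at \<open>p\<close> satisfies \<open>G c = G d\<close>.
\<close>
lemma rising_sun_components:
  fixes G :: "real \<Rightarrow> real"
  assumes G: "continuous_on {p..b} G" and top: "\<forall>y\<in>{p..b}. G y \<le> G p"
  defines "U \<equiv> {x \<in> {p<..<b}. \<exists>y\<in>{x<..b}. G x < G y}"
  shows "open U"
    and "\<And>c d. p \<le> c \<Longrightarrow> c \<le> d \<Longrightarrow> d \<le> b \<Longrightarrow> c \<notin> U \<Longrightarrow> G d \<le> G c"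
    and "\<And>c d. component_interval U c d \<Longrightarrow>
           G c = G d \<and> (\<forall>x. c < x \<longrightarrow> x < d \<longrightarrow> G x \<le> G d)"
proof -
  show "open U"
  proof -
    have "U = (\<Union>y\<in>{p<..b}. {p<..<y} \<inter> G -` {..<G y})"
      unfolding U_def by (auto 4 4)
    moreover have "open ({p<..<y} \<inter> G -` {..<G y})" if "y \<in> {p<..b}" for y
    proof (rule continuous_open_preimage)
      show "continuous_on {p<..<y} G"
        by (rule continuous_on_subset[OF G]) (use that in auto)
    qed auto
    ultimately show ?thesis by auto
  qed
  show fall: "G d \<le> G c" if "p \<le> c" "c \<le> d" "d \<le> b" "c \<notin> U" for c d
  proof (cases "c = p \<or> c = d")
    case True
    then show ?thesis using top that by auto
  next
    case False
    then show ?thesis using that unfolding U_def by (force simp: not_less)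
  qed
  fix c d assume "component_interval U c d"
  then have cd: "c < d" "{c<..<d} \<subseteq> U" "c \<notin> U" "d \<notin> U"
    by (auto simp: component_interval_def)
  have "{c<..<d} \<subseteq> {p<..<b}" using cd(2) unfolding U_def by blast
  then have pc: "p \<le> c" and db: "d \<le> b"
    using cd(1) by (auto simp: greaterThanLessThan_subseteq_greaterThanLessThan)
  have tail: "G x \<le> G d" if x: "c < x" "x < d" for x
  proof -
    have "continuous_on {x..b} G"
      by (rule continuous_on_subset[OF G]) (use x pc in auto)
    then obtain z where z: "z \<in> {x..b}" "\<And>y. y \<in> {x..b} \<Longrightarrow> G y \<le> G z"
      using continuous_attains_sup[of "{x..b}" G] x db by auto
    have "z \<notin> U"
    proof
      assume "z \<in> U"
      then obtain y where "z < y" "y \<le> b" "G z < G y" unfolding U_def by auto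
      then show False using z(1) z(2)[of y] by auto
    qed
    then have "d \<le> z" using subsetD[OF cd(2), of z] z(1) x by (cases "d \<le> z") auto
    then have "G z \<le> G d" using fall[of d z] z(1) cd pc by auto
    then show ?thesis using z(2)[of x] x db by auto
  qed
  have "continuous_on {c..d} G"
    by (rule continuous_on_subset[OF G]) (use pc db in auto)
  then have "G c \<le> G d"
    using continuous_le_on_closure[of "{c<..<d}" G c "G d"] tail cd(1) by (auto simp: closure_greaterThanLessThan)
  moreover have "G d \<le> G c" using fall[of c d] pc db cd by auto
  ultimately show "G c = G d \<and> (\<forall>x. c < x \<longrightarrow> x < d \<longrightarrow> G x \<le> G d)" using tail by auto
qed

text \<open>
  The mirror image, with the sun on the other side.  The inequality \<open>G x \<le> G d\<close> inside a component
  keeps its orientation because \<open>G c = G d\<close>; thus tails of a component, rather than initial pieces,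
  are controlled on both sides of \<open>p\<close>.
\<close>
lemma rising_sun_components_left:
  fixes G :: "real \<Rightarrow> real"
  assumes G: "continuous_on {a..p} G" and top: "\<forall>y\<in>{a..p}. G y \<le> G p"
  defines "U \<equiv> {x \<in> {a<..<p}. \<exists>y\<in>{a..<x}. G x < G y}"
  shows "open U"
    and "\<And>c d. a \<le> c \<Longrightarrow> c \<le> d \<Longrightarrow> d \<le> p \<Longrightarrow> d \<notin> U \<Longrightarrow> G c \<le> G d"
    and "\<And>c d. component_interval U c d \<Longrightarrow>
           G c = G d \<and> (\<forall>x. c < x \<longrightarrow> x < d \<longrightarrow> G x \<le> G d)"
proof -
  define H where "H x = G (- x)" for x
  define V where "V = {x \<in> {- p<..<- a}. \<exists>y\<in>{x<..- a}. H x < H y}"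
  have H: "continuous_on {- p..- a} H"
    unfolding H_def by (intro continuous_on_compose2[OF G] continuous_intros) auto
  have "\<forall>y\<in>{- p..- a}. H y \<le> H (- p)"
    using top by (simp add: H_def)
  note V = rising_sun_components[OF H this, folded V_def]
  have UV: "x \<in> U \<longleftrightarrow> - x \<in> V" for x
  proof -
    have "(\<exists>y\<in>{a..<x}. G x < G y) \<longleftrightarrow> (\<exists>y\<in>{- x<..- a}. G x < G (- y))"
      by (metis atLeastLessThan_iff greaterThanAtMost_iff minus_le_iff le_minus_iff minus_less_iff less_minus_iff minus_minus)
    then show ?thesis by (auto simp: U_def V_def H_def)
  qed
  have "U = uminus -` V" using UV by auto
  then show "open U"
    using open_vimage[OF V(1), of uminus] by (simp add: continuous_on_minus)
  show "G c \<le> G d" if "a \<le> c" "c \<le> d" "d \<le> p" "d \<notin> U" for c d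
    using V(2)[of "- d" "- c"] that UV by (simp add: H_def)
  fix c d assume "component_interval U c d"
  then have cd: "c < d" "{c<..<d} \<subseteq> U" "c \<notin> U" "d \<notin> U"
    by (auto simp: component_interval_def)
  have "{- d<..<- c} \<subseteq> V"
  proof
    fix x assume "x \<in> {- d<..<- c}"
    then have "- x \<in> {c<..<d}" by auto
    then show "x \<in> V" using cd(2) UV[of "- x"] by auto
  qed
  then have eq: "H (- d) = H (- c) \<and> (\<forall>x. - d < x \<longrightarrow> x < - c \<longrightarrow> H x \<le> H (- c))"
    using V(3)[of "- d" "- c"] cd UV by (simp add: component_interval_def)
  have "G x \<le> G d" if "c < x" "x < d" for x
    using eq that by (auto simp: H_def dest: spec[of _ "- x"])
  then show "G c = G d \<and> (\<forall>x. c < x \<longrightarrow> x < d \<longrightarrow> G x \<le> G d)"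
    using eq by (simp add: H_def)
qed

text \<open>
  For \<open>G x\<close> the integral of \<open>g\<close> over \<open>(a, x)\<close>, the shape of \<open>G\<close> on a component \<open>(c, d)\<close> says that \<open>g\<close> has
  integral 0 over \<open>(c, d)\<close> and nonnegative tails, so halving applies on it.
\<close>
lemma set_integral_open_components:
  fixes g k :: "real \<Rightarrow> real"
  assumes g: "set_integrable lebesgue {a..b} g" and k: "set_integrable lebesgue {a..b} k"
    and half: "halving_implies a b g k"
    and U: "open U" "U \<subseteq> {a<..<b}"
    and comp: "\<forall>c d. component_interval U c d \<longrightarrow>
      integral {a..c} g = integral {a..d} g \<and>
      (\<forall>x. c < x \<longrightarrow> x < d \<longrightarrow> integral {a..x} g \<le> integral {a..d} g)"
  shows "\<And>c d. component_interval U c d \<Longrightarrow> (LINT x:{c<..<d}|lebesgue. g x) = 0"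
    and "(LINT x:U|lebesgue. g x) = 0" and "0 \<le> (LINT x:U|lebesgue. k x)"
proof -
  have Um: "U \<in> sets lebesgue" using U(1) by auto
  have UI: "U \<subseteq> {a..b}" using U(2) by force
  note bounds = component_interval_bounds[OF _ UI]
  have gU: "set_integrable lebesgue U g" and kU: "set_integrable lebesgue U k"
    using set_integrable_subset[OF g Um UI] set_integrable_subset[OF k Um UI] by auto
  show zero: "(LINT x:{c<..<d}|lebesgue. g x) = 0" if "component_interval U c d" for c d
    using comp that bounds[OF that]
    by (subst set_integral_Ioo_eq_diff[OF g]) auto
  have "0 \<le> (LINT x:U|lebesgue. g x)"
    by (rule set_integral_nonneg_by_components[OF U(1) UI gU]) (simp add: zero)
  moreover have "0 \<le> (LINT x:U|lebesgue. - g x)"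
  proof (rule set_integral_nonneg_by_components[OF U(1) UI])
    show "set_integrable lebesgue U (\<lambda>x. - g x)" using gU by (simp add: set_integrable_def)
    fix c d assume "component_interval U c d"
    from zero[OF this] show "0 \<le> (LINT x:{c<..<d}|lebesgue. - g x)"
      by (simp add: set_lebesgue_integral_def)
  qed
  ultimately show "(LINT x:U|lebesgue. g x) = 0" by (simp add: set_lebesgue_integral_def)
  show "0 \<le> (LINT x:U|lebesgue. k x)"
  proof (rule set_integral_nonneg_by_components[OF U(1) UI kU])
    fix c d assume cd: "component_interval U c d"
    note b = bounds[OF cd]
    show "0 \<le> (LINT x:{c<..<d}|lebesgue. k x)"
    proof (rule set_integral_nonneg_by_halving[where g = g])
      show "set_integrable lebesgue {c..d} k"
        by (rule set_integrable_subset[OF k]) (use b in auto)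
      show "0 \<le> (LINT y:{x<..<d}|lebesgue. g y)" if "c < x" "x < d" for x
        using comp cd that b by (subst set_integral_Ioo_eq_diff[OF g]) auto
      show "halving_implies c d g k"
        using half b unfolding halving_implies_def by auto
    qed (use b in auto)
  qed
qed

text \<open>
  The outcome for the part of an interval to the right of \<open>p\<close>: up to a null set \<open>{g > 0}\<close> lies in a
  set \<open>U\<close> over which \<open>g\<close> has mean exactly 0 and \<open>k\<close> has nonnegative integral.
\<close>
lemma rising_sun_right:
  fixes g k :: "real \<Rightarrow> real"
  assumes g: "set_integrable lebesgue {p..b} g" and k: "set_integrable lebesgue {p..b} k"
    and half: "halving_implies p b g k"
    and prefix: "\<forall>y\<in>{p..b}. (LINT x:{p<..<y}|lebesgue. g x) \<le> 0"
  obtains U where "U \<in> sets lebesgue" "U \<subseteq> {p<..<b}"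
    "(LINT x:U|lebesgue. g x) = 0" "0 \<le> (LINT x:U|lebesgue. k x)"
    "AE x in lebesgue. x \<in> {p<..<b} - U \<longrightarrow> g x \<le> 0"
proof -
  define G where "G x = integral {p..x} g" for x
  have Gp: "G p = 0" by (simp add: G_def)
  define U where "U = {x \<in> {p<..<b}. \<exists>y\<in>{x<..b}. G x < G y}"
  have cont: "continuous_on {p..b} G"
    unfolding G_def by (rule continuous_on_integral_Icc[OF g])
  have top: "\<forall>y\<in>{p..b}. G y \<le> G p"
    using prefix set_integral_Ioo_eq_diff[OF g, of p] by (simp add: G_def)
  note R = rising_sun_components[OF cont top, folded U_def]
  have UI: "U \<subseteq> {p<..<b}" by (auto simp: U_def)
  have comp: "\<forall>c d. component_interval U c d \<longrightarrow> G c = G d \<and> (\<forall>x. c < x \<longrightarrow> x < d \<longrightarrow> G x \<le> G d)"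
    using R(3) by blast
  note I = set_integral_open_components[OF g k half R(1) UI comp[unfolded G_def]]
  have "AE x in lebesgue. x \<in> {p<..<b} - U \<longrightarrow> g x \<le> 0"
  proof (rule AE_nonpos_outside_open[OF R(1) UI g])
    fix c d assume "p \<le> c" "c < d" "d \<le> b" "c \<notin> U"
    then show "(LINT x:{c<..<d}|lebesgue. g x) \<le> 0"
      using R(2)[of c d] by (subst set_integral_Ioo_eq_diff[OF g]) (auto simp: G_def)
  qed (simp add: I(1))
  then show ?thesis using I(2,3) UI R(1) by (intro that[of U]) auto
qed

text \<open>
  To the left of \<open>p\<close> it is \<open>{g < 0}\<close> that is captured by \<open>U\<close>, while the roles of \<open>g\<close> and \<open>k\<close> on \<open>U\<close> are
  the same as before.
\<close>
lemma rising_sun_left: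
  fixes g k :: "real \<Rightarrow> real"
  assumes g: "set_integrable lebesgue {a..p} g" and k: "set_integrable lebesgue {a..p} k"
    and half: "halving_implies a p g k"
    and suffix: "\<forall>y\<in>{a..p}. 0 \<le> (LINT x:{y<..<p}|lebesgue. g x)"
  obtains U where "U \<in> sets lebesgue" "U \<subseteq> {a<..<p}"
    "(LINT x:U|lebesgue. g x) = 0" "0 \<le> (LINT x:U|lebesgue. k x)"
    "AE x in lebesgue. x \<in> {a<..<p} - U \<longrightarrow> 0 \<le> g x"
proof -
  define G where "G x = integral {a..x} g" for x
  define U where "U = {x \<in> {a<..<p}. \<exists>y\<in>{a..<x}. G x < G y}"
  have cont: "continuous_on {a..p} G"
    unfolding G_def by (rule continuous_on_integral_Icc[OF g])
  have top: "\<forall>y\<in>{a..p}. G y \<le> G p"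
    using suffix set_integral_Ioo_eq_diff[OF g, of _ p] by (auto simp: G_def)
  note R = rising_sun_components_left[OF cont top, folded U_def]
  have UI: "U \<subseteq> {a<..<p}" by (auto simp: U_def)
  have comp: "\<forall>c d. component_interval U c d \<longrightarrow> G c = G d \<and> (\<forall>x. c < x \<longrightarrow> x < d \<longrightarrow> G x \<le> G d)"
    using R(3) by blast
  note I = set_integral_open_components[OF g k half R(1) UI comp[unfolded G_def]]
  have "AE x in lebesgue. x \<in> {a<..<p} - U \<longrightarrow> - g x \<le> 0"
  proof (rule AE_nonpos_outside_open[OF R(1) UI])
    show "set_integrable lebesgue {a..p} (\<lambda>x. - g x)" using g by (simp add: set_integrable_def)
    fix c d assume cd: "a \<le> c" "c < d" "d \<le> p" "d \<notin> U"
    then have "0 \<le> (LINT x:{c<..<d}|lebesgue. g x)"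
      using R(2)[of c d] by (subst set_integral_Ioo_eq_diff[OF g]) (auto simp: G_def)
    then show "(LINT x:{c<..<d}|lebesgue. - g x) \<le> 0" by (simp add: set_lebesgue_integral_def)
  next
    fix c d assume "component_interval U c d"
    from I(1)[OF this] show "0 \<le> (LINT x:{c<..<d}|lebesgue. - g x)"
      by (simp add: set_lebesgue_integral_def)
  qed
  then have "AE x in lebesgue. x \<in> {a<..<p} - U \<longrightarrow> 0 \<le> g x" by simp
  then show ?thesis using I(2,3) UI R(1) by (intro that[of U]) auto
qed

text \<open>
  Taking \<open>p\<close> where the primitive of \<open>g\<close> is largest makes both versions of the rising sun lemma
  applicable, one on each side of \<open>p\<close>, so that no component is cut off by an endpoint of the
  interval.
\<close>
lemma splitting_point:
  fixes g :: "real \<Rightarrow> real"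
  assumes g: "set_integrable lebesgue {a..b} g" and "a \<le> b"
  obtains p where "a \<le> p" "p \<le> b"
    "\<forall>y\<in>{p..b}. (LINT x:{p<..<y}|lebesgue. g x) \<le> 0"
    "\<forall>y\<in>{a..p}. 0 \<le> (LINT x:{y<..<p}|lebesgue. g x)"
proof -
  define G where "G x = integral {a..x} g" for x
  have "continuous_on {a..b} G"
    unfolding G_def by (rule continuous_on_integral_Icc[OF g])
  then obtain p where p: "p \<in> {a..b}" "\<And>y. y \<in> {a..b} \<Longrightarrow> G y \<le> G p"
    using continuous_attains_sup[of "{a..b}" G] \<open>a \<le> b\<close> by auto
  have "(LINT x:{p<..<y}|lebesgue. g x) \<le> 0" if "y \<in> {p..b}" for y
    using p that by (subst set_integral_Ioo_eq_diff[OF g]) (auto simp: G_def)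
  moreover have "0 \<le> (LINT x:{y<..<p}|lebesgue. g x)" if "y \<in> {a..p}" for y
    using p that by (subst set_integral_Ioo_eq_diff[OF g]) (auto simp: G_def)
  ultimately show ?thesis using p(1) by (intro that[of p]) auto
qed

section \<open>Medians and level sets\<close>

lemma level_sets_lmeasurable:
  fixes f :: "real \<Rightarrow> real"
  assumes f: "f \<in> borel_measurable lebesgue"
  shows "{x \<in> {c<..<d}. f x < l} \<in> lmeasurable" and "{x \<in> {c<..<d}. l < f x} \<in> lmeasurable"
    and "{c<..<d} \<inter> {x. f x \<le> l} \<in> lmeasurable"
proof -
  have *: "{c<..<d} \<inter> S \<in> lmeasurable" if "S \<in> sets lebesgue" for S
    using that by (intro fmeasurable_Int_fmeasurable) auto
  have "{x. f x < l} \<in> sets lebesgue" "{x. l < f x} \<in> sets lebesgue" "{x. f x \<le> l} \<in> sets lebesgue"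
    using f borel_measurable_iff_less[of f lebesgue] borel_measurable_iff_greater[of f lebesgue]
      borel_measurable_iff_le[of f lebesgue] by simp_all
  from this[THEN *] show "{x \<in> {c<..<d}. f x < l} \<in> lmeasurable"
    "{x \<in> {c<..<d}. l < f x} \<in> lmeasurable" "{c<..<d} \<inter> {x. f x \<le> l} \<in> lmeasurable"
    by (simp_all add: Int_def)
qed

text \<open>
  As the level tends to infinity or minus infinity, the sublevel sets exhaust the interval or
  shrink to the empty set, and continuity of the measure applies.
\<close>
lemma
  fixes f :: "real \<Rightarrow> real"
  assumes f: "f \<in> borel_measurable lebesgue" and s: "0 < s" "s < 1" and "c < d"
  shows bdd_above_median_levels:
      "bdd_above {l. measure lebesgue {x \<in> {c<..<d}. f x < l} \<le> s * measure lebesgue {c<..<d}}"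
    and median_levels_nonempty:
      "{l. measure lebesgue {x \<in> {c<..<d}. f x < l} \<le> s * measure lebesgue {c<..<d}} \<noteq> {}"
proof -
  define A where "A l = {x \<in> {c<..<d}. f x < l}" for l
  have A: "A l \<in> lmeasurable" for l
    unfolding A_def by (rule level_sets_lmeasurable(1)[OF f])
  have A_mono: "A l \<subseteq> A l'" if "l \<le> l'" for l l'
    using that by (auto simp: A_def)
  define M where "M = measure lebesgue {c<..<d}"
  have M: "0 < M" using \<open>c < d\<close> by (simp add: M_def)
  have "bdd_above {l. measure lebesgue (A l) \<le> s * M}"
  proof -
    have "x \<in> (\<Union>n. A (real n)) \<longleftrightarrow> x \<in> {c<..<d}" for x
      using reals_Archimedean2[of "f x"] by (auto simp: A_def)
    then have Un: "(\<Union>n. A (real n)) = {c<..<d}" by blast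
    have "(\<lambda>n. measure lebesgue (A (real n))) \<longlonglongrightarrow> measure lebesgue (\<Union>n. A (real n))"
    proof (rule Lim_measure_incseq)
      show "range (\<lambda>n. A (real n)) \<subseteq> sets lebesgue" using fmeasurableD[OF A] by blast
      show "incseq (\<lambda>n. A (real n))" unfolding incseq_def by (simp add: A_mono)
      show "emeasure lebesgue (\<Union>n. A (real n)) \<noteq> \<infinity>" unfolding Un using \<open>c < d\<close> by simp
    qed
    then have "(\<lambda>n. measure lebesgue (A (real n))) \<longlonglongrightarrow> M" unfolding Un M_def .
    moreover have "s * M < M" using s M by simp
    ultimately obtain n where n: "s * M < measure lebesgue (A (real n))"
      using eventually_happens'[OF sequentially_bot order_tendstoD(1)] by blast
    show ?thesis
    proof (rule bdd_aboveI[of _ "real n"], rule ccontr)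
      fix l assume l: "l \<in> {l. measure lebesgue (A l) \<le> s * M}" "\<not> l \<le> real n"
      then have "measure lebesgue (A (real n)) \<le> measure lebesgue (A l)"
        by (intro measure_mono_fmeasurable fmeasurableD A A_mono) simp
      then show False using n l(1) by simp
    qed
  qed
  then show "bdd_above {l. measure lebesgue {x \<in> {c<..<d}. f x < l} \<le> s * measure lebesgue {c<..<d}}"
    unfolding A_def M_def .
  have "{l. measure lebesgue (A l) \<le> s * M} \<noteq> {}"
  proof -
    have "x \<notin> (\<Inter>n. A (- real n))" for x
      using real_arch_simple[of "- f x"] by (auto simp: A_def not_less minus_le_iff)
    then have Int: "(\<Inter>n. A (- real n)) = {}" by blast
    have "(\<lambda>n. measure lebesgue (A (- real n))) \<longlonglongrightarrow> measure lebesgue (\<Inter>n. A (- real n))"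
    proof (rule Lim_measure_decseq)
      show "range (\<lambda>n. A (- real n)) \<subseteq> sets lebesgue" using fmeasurableD[OF A] by blast
      show "decseq (\<lambda>n. A (- real n))" unfolding decseq_def by (simp add: A_mono)
      show "emeasure lebesgue (A (- real n)) \<noteq> \<infinity>" for n
        using fmeasurableD2[OF A] by simp
    qed
    then have "(\<lambda>n. measure lebesgue (A (- real n))) \<longlonglongrightarrow> 0" unfolding Int by simp
    moreover have "0 < s * M" using s M by simp
    ultimately obtain n where "measure lebesgue (A (- real n)) < s * M"
      using eventually_happens'[OF sequentially_bot order_tendstoD(2)] by blast
    then show ?thesis using less_imp_le by blast
  qed
  then show "{l. measure lebesgue {x \<in> {c<..<d}. f x < l} \<le> s * measure lebesgue {c<..<d}} \<noteq> {}"
    unfolding A_def M_def .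
qed

lemma measure_less_max_median:
  fixes f :: "real \<Rightarrow> real"
  assumes f: "f \<in> borel_measurable lebesgue" and s: "0 < s" "s < 1" and "c < d"
    and m: "m < max_median s f {c<..<d}"
  shows "measure lebesgue {x \<in> {c<..<d}. f x < m} \<le> s * (d - c)"
proof -
  obtain l where "l \<in> {l. measure lebesgue {x \<in> {c<..<d}. f x < l} \<le> s * measure lebesgue {c<..<d}}"
    and ml: "m < l"
    by (rule less_cSupE[OF m[unfolded max_median_def] median_levels_nonempty[OF f s \<open>c < d\<close>]])
  then have l: "measure lebesgue {x \<in> {c<..<d}. f x < l} \<le> s * measure lebesgue {c<..<d}" by simp
  have "measure lebesgue {x \<in> {c<..<d}. f x < m} \<le> measure lebesgue {x \<in> {c<..<d}. f x < l}"
  proof (rule measure_mono_fmeasurable)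
    show "{x \<in> {c<..<d}. f x < m} \<in> sets lebesgue"
      by (rule fmeasurableD[OF level_sets_lmeasurable(1)[OF f]])
    show "{x \<in> {c<..<d}. f x < l} \<in> lmeasurable" by (rule level_sets_lmeasurable(1)[OF f])
  qed (use ml in auto)
  also have "\<dots> \<le> s * measure lebesgue {c<..<d}" by (rule l)
  also have "\<dots> = s * (d - c)" using \<open>c < d\<close> by simp
  finally show ?thesis .
qed

lemma max_median_less_measure:
  fixes f :: "real \<Rightarrow> real"
  assumes f: "f \<in> borel_measurable lebesgue" and s: "0 < s" "s < 1" and "c < d"
    and m: "max_median s f {c<..<d} < m"
  shows "s * (d - c) < measure lebesgue {x \<in> {c<..<d}. f x < m}"
proof (rule ccontr)
  assume "\<not> ?thesis"
  then have "m \<le> max_median s f {c<..<d}"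
    unfolding max_median_def using \<open>c < d\<close>
    by (intro cSup_upper bdd_above_median_levels[OF f s]) auto
  then show False using m by simp
qed

text \<open>
  The median condition restated without medians: if \<open>{f \<le> v}\<close> has density at least \<open>s' > s\<close> in a
  right half, then the larger sublevel set \<open>{f \<le> v + C'}\<close> has density at least \<open>t\<close> in the left half.
\<close>
lemma median_gap_propagates:
  fixes f :: "real \<Rightarrow> real"
  assumes f: "f \<in> borel_measurable lebesgue" and st: "0 < s" "s < s'" "s < 1" "0 < t" "t < 1"
    and gap: "\<forall>a b. a < b \<longrightarrow> max_median t f (left_half a b) - max_median s f (right_half a b) \<le> C"
    and "C < C'" and "x < d" and m: "m = (x + d) / 2"
    and dens: "s' * (d - m) \<le> measure lebesgue ({m<..<d} \<inter> {y. f y \<le> v})"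
  shows "t * (m - x) \<le> measure lebesgue ({x<..<m} \<inter> {y. f y \<le> v + C'})"
proof (rule ccontr)
  have xm: "x < m" "m < d" using \<open>x < d\<close> m by simp_all
  note fin = level_sets_lmeasurable[OF f]
  assume neg: "\<not> t * (m - x) \<le> measure lebesgue ({x<..<m} \<inter> {y. f y \<le> v + C'})"
  have left: "v + C' \<le> max_median t f {x<..<m}"
  proof (rule ccontr)
    assume "\<not> v + C' \<le> max_median t f {x<..<m}"
    then have "t * (m - x) < measure lebesgue {y \<in> {x<..<m}. f y < v + C'}"
      by (intro max_median_less_measure[OF f st(4,5) xm(1)]) (simp only: not_le)
    also have "\<dots> \<le> measure lebesgue ({x<..<m} \<inter> {y. f y \<le> v + C'})"
      by (rule measure_mono_fmeasurable[OF _ fmeasurableD[OF fin(1)] fin(3)]) auto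
    finally show False using neg by simp
  qed
  have right: "max_median s f {m<..<d} \<le> v"
  proof (rule ccontr)
    assume "\<not> max_median s f {m<..<d} \<le> v"
    then obtain l where l: "v < l" "l < max_median s f {m<..<d}"
      using dense[of v "max_median s f {m<..<d}"] by (auto simp: not_le)
    note dens
    also have "measure lebesgue ({m<..<d} \<inter> {y. f y \<le> v}) \<le> measure lebesgue {y \<in> {m<..<d}. f y < l}"
      by (rule measure_mono_fmeasurable[OF _ fmeasurableD[OF fin(3)] fin(1)]) (use l(1) in auto)
    also have "\<dots> \<le> s * (d - m)"
      by (rule measure_less_max_median[OF f st(1,3) xm(2) l(2)])
    finally show False using st(2) xm(2) by (simp add: mult_le_cancel_right)
  qed
  have "left_half x d = {x<..<m}" "right_half x d = {m<..<d}"
    unfolding left_half_def right_half_def m by (rule refl)+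
  then show False
    using gap[rule_format, OF \<open>x < d\<close>] \<open>C < C'\<close> left right by simp
qed

section \<open>Splitting points from the median condition\<close>

text \<open>
  The property through which both conditions are compared.  For every interval and level there
  is a point \<open>p\<close> such that \<open>f\<close> hardly exceeds the level before \<open>p\<close> and hardly falls below it after \<open>p\<close>,
  with a decay \<open>\<phi>\<close> in the distance \<open>l\<close> to the level.  It matters that \<open>p\<close> does not depend on \<open>l\<close>.
\<close>
definition splits_levels :: "(real \<Rightarrow> real) \<Rightarrow> (real \<Rightarrow> real) \<Rightarrow> bool" where
  "splits_levels f \<phi> \<longleftrightarrow> (\<forall>a b \<mu>. a < b \<longrightarrow> (\<exists>p\<in>{a..b}. \<forall>l>0.
     measure lebesgue {x \<in> {a<..<p}. \<mu> + l < f x} \<le> \<phi> l * (p - a) \<and>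
     measure lebesgue {x \<in> {p<..<b}. f x < \<mu> - l} \<le> \<phi> l * (b - p)))"

lemma set_integral_indicator_minus_const:
  fixes S :: "real set"
  assumes "S \<in> lmeasurable" "E \<in> sets lebesgue"
  shows "set_integrable lebesgue S (\<lambda>x. indicator E x - c)"
    and "(LINT x:S|lebesgue. indicator E x - c) = measure lebesgue (S \<inter> E) - c * measure lebesgue S"
proof -
  have SE: "S \<inter> E \<in> lmeasurable" using assms by (rule fmeasurable_Int_fmeasurable)
  have i: "integrable lebesgue (indicator S :: real \<Rightarrow> real)"
    using assms(1) by (simp add: lmeasurable_iff_integrable)
  have j: "integrable lebesgue (indicator (S \<inter> E) :: real \<Rightarrow> real)"
    using SE by (simp add: lmeasurable_iff_integrable)
  have eq: "indicator S x *\<^sub>R (indicator E x - c) = indicator (S \<inter> E) x - c * indicator S x" for x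
    by (auto simp: indicator_def)
  show "set_integrable lebesgue S (\<lambda>x. indicator E x - c)"
    unfolding set_integrable_def eq using i j by simp
  show "(LINT x:S|lebesgue. indicator E x - c) = measure lebesgue (S \<inter> E) - c * measure lebesgue S"
    unfolding set_lebesgue_integral_def eq using i j by simp
qed

text \<open>
  Choose \<open>p\<close> for \<open>g = 1\<^sub>E - s'\<close> with \<open>E = {f \<le> \<mu>}\<close> and \<open>s < s' < t\<close>.  Sublevel sets at lower levels are
  smaller, so the same \<open>p\<close> serves for all of them on its right; those at higher levels are larger,
  so it serves for them on its left.  Each use of the rising sun lemma compares two levels at
  distance \<open>C'\<close>.  On the right, the lower sublevel set has density \<open>s'\<close> in \<open>U\<close> and the next one density
  at least \<open>t\<close>, so going down one level costs a factor \<open>s' / t\<close>; on the left, the complements have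
  density \<open>1 - s'\<close> and at most \<open>1 - t\<close>, so going up costs a factor \<open>(1 - t) / (1 - s')\<close>.  Iteration gives
  exponential decay.
\<close>
lemma splits_levels_of_median_gap:
  fixes f :: "real \<Rightarrow> real"
  assumes f: "f \<in> borel_measurable lebesgue" and st: "0 < s" "s < t" "t < 1"
    and gap: "\<forall>a b. a < b \<longrightarrow> max_median t f (left_half a b) - max_median s f (right_half a b) \<le> C"
    and "0 < C"
  obtains r where "0 < r" "r < 1" "splits_levels f (\<lambda>l. r ^ nat \<lfloor>l / (2 * C)\<rfloor>)"
proof -
  define s' where "s' = (s + t) / 2"
  have s': "s < s'" "s' < t" "0 < s'" using st by (auto simp: s'_def)
  define C' where "C' = 2 * C"
  have C': "0 < C'" "C < C'" using \<open>0 < C\<close> by (auto simp: C'_def)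
  define r where "r = max (s' / t) ((1 - t) / (1 - s'))"
  have r: "0 < r" "r < 1" "s' \<le> r * t" "1 - t \<le> r * (1 - s')"
    using s' st by (auto simp: r_def less_max_iff_disj divide_simps max_def)
  define E where "E v = {x. f x \<le> v}" for v
  have Em: "E v \<in> sets lebesgue" for v
    using f by (simp add: E_def borel_measurable_iff_le)
  have Emono: "E v \<subseteq> E w" if "v \<le> w" for v w using that by (auto simp: E_def)
  define g where "g v x = indicator (E v) x - s'" for v x
  define k where "k v x = indicator (E (v + C')) x - t" for v x
  have gi: "set_integrable lebesgue {c..d} (g v)" and ki: "set_integrable lebesgue {c..d} (k v)" for c d v
    unfolding g_def k_def by (intro set_integral_indicator_minus_const Em; simp)+
  have gI: "(LINT x:S|lebesgue. g v x) = measure lebesgue (S \<inter> E v) - s' * measure lebesgue S"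
    and kI: "(LINT x:S|lebesgue. k v x) = measure lebesgue (S \<inter> E (v + C')) - t * measure lebesgue S"
    if "S \<in> lmeasurable" for S v
    unfolding g_def k_def by (intro set_integral_indicator_minus_const(2) Em that)+
  have half: "halving_implies c e (g v) (k v)" for c e v
    unfolding halving_implies_def
  proof (intro allI impI, elim conjE)
    fix x d assume "x < d" and pos: "0 \<le> (LINT y:{(x + d) / 2<..<d}|lebesgue. g v y)"
    define m where "m = (x + d) / 2"
    have xm: "x < m" "m < d" using \<open>x < d\<close> m_def by simp_all
    have dens: "s' * (d - m) \<le> measure lebesgue ({m<..<d} \<inter> {y. f y \<le> v})"
      using pos xm unfolding m_def[symmetric] by (simp add: gI E_def)
    have "t * (m - x) \<le> measure lebesgue ({x<..<m} \<inter> {y. f y \<le> v + C'})"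
      by (rule median_gap_propagates[OF f _ s'(1) _ _ _ gap C'(2) \<open>x < d\<close> m_def dens]) (use st in auto)
    then show "0 \<le> (LINT y:{x<..<(x + d) / 2}|lebesgue. k v y)"
      unfolding m_def[symmetric] using xm by (simp add: kI E_def)
  qed
  have lm: "S \<inter> E v \<in> lmeasurable" "S - E v \<in> lmeasurable" if "S \<in> lmeasurable" for S v
    using fmeasurable_Int_fmeasurable[OF that Em] fmeasurable_Diff[OF that Em] by simp_all
  have g_mono: "(LINT x:S|lebesgue. g v x) \<le> (LINT x:S|lebesgue. g w x)"
    if "S \<in> lmeasurable" "v \<le> w" for S v w
  proof -
    have "measure lebesgue (S \<inter> E v) \<le> measure lebesgue (S \<inter> E w)"
      by (rule measure_mono_fmeasurable[OF _ fmeasurableD[OF lm(1)] lm(1)]) (use that Emono[OF that(2)] in auto)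
    then show ?thesis using gI[OF that(1)] by simp
  qed
  have diff: "measure lebesgue (S - E v) = measure lebesgue S - measure lebesgue (S \<inter> E v)"
    if "S \<in> lmeasurable" for S v
    using measurable_measure_Diff[OF that fmeasurableD[OF lm(1)[OF that, of v]]] by (simp add: Diff_Int)
  have main: "\<exists>p\<in>{a..b}. \<forall>l>0.
     measure lebesgue {x \<in> {a<..<p}. \<mu> + l < f x} \<le> r ^ nat \<lfloor>l / C'\<rfloor> * (p - a) \<and>
     measure lebesgue {x \<in> {p<..<b}. f x < \<mu> - l} \<le> r ^ nat \<lfloor>l / C'\<rfloor> * (b - p)"
    if ab: "a < b" for a b \<mu>
  proof -
    obtain p where p: "a \<le> p" "p \<le> b"
      and prefix: "\<forall>y\<in>{p..b}. (LINT x:{p<..<y}|lebesgue. g \<mu> x) \<le> 0"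
      and suffix: "\<forall>y\<in>{a..p}. 0 \<le> (LINT x:{y<..<p}|lebesgue. g \<mu> x)"
      by (rule splitting_point[OF gi less_imp_le[OF ab], of \<mu>]) auto
    have right: "measure lebesgue ({p<..<b} \<inter> E (\<mu> - real j * C')) \<le> r ^ j * (b - p)" for j
    proof (induction j)
      case 0
      have "measure lebesgue ({p<..<b} \<inter> E \<mu>) \<le> measure lebesgue {p<..<b}"
        by (rule measure_mono_fmeasurable[OF _ fmeasurableD[OF lm(1)]]) auto
      then show ?case using p by simp
    next
      case (Suc j)
      define v where "v = \<mu> - real (Suc j) * C'"
      have vC: "v + C' = \<mu> - real j * C'" by (simp add: v_def algebra_simps)
      have "v \<le> \<mu>" using C' by (simp add: v_def)
      have pre: "\<forall>y\<in>{p..b}. (LINT x:{p<..<y}|lebesgue. g v x) \<le> 0"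
        using prefix g_mono[OF _ \<open>v \<le> \<mu>\<close>] by (meson lmeasurable_interval(2) order_trans)
      obtain U where U: "U \<in> sets lebesgue" "U \<subseteq> {p<..<b}"
        "(LINT x:U|lebesgue. g v x) = 0" "0 \<le> (LINT x:U|lebesgue. k v x)"
        "AE x in lebesgue. x \<in> {p<..<b} - U \<longrightarrow> g v x \<le> 0"
        by (rule rising_sun_right[OF gi ki half pre])
      have Ul: "U \<in> lmeasurable" by (rule fmeasurableI2[OF lmeasurable_interval(2) U(2,1)])
      have "measure lebesgue ({p<..<b} \<inter> E v) = measure lebesgue (U \<inter> E v)"
      proof (rule measure_eq_AE)
        have pos: "0 < g v x" if "x \<in> E v" for x using that s' st by (simp add: g_def)
        show "AE x in lebesgue. x \<in> {p<..<b} \<inter> E v \<longleftrightarrow> x \<in> U \<inter> E v"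
          using U(5) by eventually_elim (use U(2) pos in force)
      qed (use Em U in auto)
      also have "\<dots> = s' * measure lebesgue U" using U(3) gI[OF Ul, of v] by simp
      also have "\<dots> \<le> r * (t * measure lebesgue U)"
        unfolding mult.assoc[symmetric] by (rule mult_right_mono[OF r(3) measure_nonneg])
      also have "\<dots> \<le> r * measure lebesgue (U \<inter> E (v + C'))"
        using U(4) kI[OF Ul, of v] r(1) by (intro mult_left_mono) auto
      also have "\<dots> \<le> r * measure lebesgue ({p<..<b} \<inter> E (v + C'))"
      proof (rule mult_left_mono)
        show "measure lebesgue (U \<inter> E (v + C')) \<le> measure lebesgue ({p<..<b} \<inter> E (v + C'))"
          by (rule measure_mono_fmeasurable[OF _ fmeasurableD[OF lm(1)[OF Ul]] lm(1)]) (use U(2) in auto)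
      qed (use r in simp)
      also have "\<dots> \<le> r * (r ^ j * (b - p))"
        unfolding vC using r(1) by (intro mult_left_mono[OF Suc]) simp
      finally show ?case unfolding v_def by (simp only: power_Suc mult.assoc)
    qed
    have left: "measure lebesgue ({a<..<p} - E (\<mu> + real j * C')) \<le> r ^ j * (p - a)" for j
    proof (induction j)
      case 0
      have "measure lebesgue ({a<..<p} - E \<mu>) \<le> measure lebesgue {a<..<p}"
        by (rule measure_mono_fmeasurable[OF _ fmeasurableD[OF lm(2)]]) auto
      then show ?case using p by simp
    next
      case (Suc j)
      define v where "v = \<mu> + real j * C'"
      have vC: "v + C' = \<mu> + real (Suc j) * C'" by (simp add: v_def algebra_simps)
      have "\<mu> \<le> v" using C' by (simp add: v_def)
      have suf: "\<forall>y\<in>{a..p}. 0 \<le> (LINT x:{y<..<p}|lebesgue. g v x)"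
        using suffix g_mono[OF _ \<open>\<mu> \<le> v\<close>] by (meson lmeasurable_interval(2) order_trans)
      obtain U where U: "U \<in> sets lebesgue" "U \<subseteq> {a<..<p}"
        "(LINT x:U|lebesgue. g v x) = 0" "0 \<le> (LINT x:U|lebesgue. k v x)"
        "AE x in lebesgue. x \<in> {a<..<p} - U \<longrightarrow> 0 \<le> g v x"
        by (rule rising_sun_left[OF gi ki half suf])
      have Ul: "U \<in> lmeasurable" by (rule fmeasurableI2[OF lmeasurable_interval(2) U(2,1)])
      have "measure lebesgue ({a<..<p} - E (v + C')) = measure lebesgue (U - E (v + C'))"
      proof (rule measure_eq_AE)
        have "E v \<subseteq> E (v + C')" using C' by (intro Emono) simp
        then have neg: "g v x < 0" if "x \<notin> E (v + C')" for x
          using that s' by (auto simp: g_def indicator_def)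
        show "AE x in lebesgue. x \<in> {a<..<p} - E (v + C') \<longleftrightarrow> x \<in> U - E (v + C')"
          using U(5) by eventually_elim (use U(2) neg in force)
      qed (use Em U in auto)
      also have "\<dots> \<le> (1 - t) * measure lebesgue U"
        using U(4) kI[OF Ul, of v] diff[OF Ul, of "v + C'"] by (simp add: left_diff_distrib)
      also have "\<dots> \<le> r * ((1 - s') * measure lebesgue U)"
        unfolding mult.assoc[symmetric] by (rule mult_right_mono[OF r(4) measure_nonneg])
      also have "\<dots> = r * measure lebesgue (U - E v)"
        using U(3) gI[OF Ul, of v] diff[OF Ul, of v] by (simp add: left_diff_distrib)
      also have "\<dots> \<le> r * measure lebesgue ({a<..<p} - E v)"
      proof (rule mult_left_mono)
        show "measure lebesgue (U - E v) \<le> measure lebesgue ({a<..<p} - E v)"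
          by (rule measure_mono_fmeasurable[OF _ fmeasurableD[OF lm(2)[OF Ul]] lm(2)]) (use U(2) in auto)
      qed (use r in simp)
      also have "\<dots> \<le> r * (r ^ j * (p - a))"
        unfolding v_def using r(1) by (intro mult_left_mono[OF Suc]) simp
      finally show ?case unfolding vC by (simp only: power_Suc mult.assoc)
    qed
    have "measure lebesgue {x \<in> {a<..<p}. \<mu> + l < f x} \<le> r ^ nat \<lfloor>l / C'\<rfloor> * (p - a) \<and>
        measure lebesgue {x \<in> {p<..<b}. f x < \<mu> - l} \<le> r ^ nat \<lfloor>l / C'\<rfloor> * (b - p)" if "0 < l" for l
    proof -
      have "real (nat \<lfloor>l / C'\<rfloor>) \<le> l / C'" using \<open>0 < l\<close> C' by simp
      then have jl: "real (nat \<lfloor>l / C'\<rfloor>) * C' \<le> l" using C' by (simp add: le_divide_eq)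
      note m = level_sets_lmeasurable[OF f, THEN fmeasurableD]
      have "measure lebesgue {x \<in> {a<..<p}. \<mu> + l < f x}
          \<le> measure lebesgue ({a<..<p} - E (\<mu> + real (nat \<lfloor>l / C'\<rfloor>) * C'))"
        by (rule measure_mono_fmeasurable[OF _ m(2) lm(2)]) (use jl in \<open>auto simp: E_def\<close>)
      moreover have "measure lebesgue {x \<in> {p<..<b}. f x < \<mu> - l}
          \<le> measure lebesgue ({p<..<b} \<inter> E (\<mu> - real (nat \<lfloor>l / C'\<rfloor>) * C'))"
        by (rule measure_mono_fmeasurable[OF _ m(1) lm(1)]) (use jl in \<open>auto simp: E_def\<close>)
      ultimately show ?thesis using left right by (meson order_trans)
    qed
    then show ?thesis using p by (intro bexI[of _ p] allI impI) simp_all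
  qed
  have "splits_levels f (\<lambda>l. r ^ nat \<lfloor>l / (2 * C)\<rfloor>)"
    unfolding splits_levels_def C'_def[symmetric] by (intro allI impI main)
  then show ?thesis by (rule that[OF r(1,2)])
qed

section \<open>Splitting points from one-sided bounded mean oscillation\<close>

lemma BMO_plus_iff:
  "f \<in> BMO_plus \<longleftrightarrow> locally_integrable f \<and> (\<exists>N. \<forall>a b. a < b \<longrightarrow>
     average (\<lambda>x. max (f x - average f (right_half a b)) 0) (left_half a b) \<le> N)"
proof -
  define V where "V = (\<lambda>(a, b). average (\<lambda>x. max (f x - average f (right_half a b)) 0) (left_half a b))"
  let ?P = "{(a, b). a < b} :: (real \<times> real) set"
  have "(SUP z\<in>?P. ereal (V z)) < \<infinity> \<longleftrightarrow> (\<exists>N. \<forall>z\<in>?P. V z \<le> N)"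
  proof
    assume fin: "(SUP z\<in>?P. ereal (V z)) < \<infinity>"
    then obtain N where "(SUP z\<in>?P. ereal (V z)) \<le> ereal N"
      by (cases "SUP z\<in>?P. ereal (V z)") auto
    then have "\<forall>z\<in>?P. V z \<le> N" by (auto simp: SUP_le_iff)
    then show "\<exists>N. \<forall>z\<in>?P. V z \<le> N" by blast
  next
    assume "\<exists>N. \<forall>z\<in>?P. V z \<le> N"
    then obtain N where "\<forall>z\<in>?P. V z \<le> N" by blast
    then have "(SUP z\<in>?P. ereal (V z)) \<le> ereal N" by (auto simp: SUP_le_iff)
    then show "(SUP z\<in>?P. ereal (V z)) < \<infinity>" by (rule le_less_trans) simp
  qed
  moreover have "(\<lambda>(a, b). ereal (average (\<lambda>x. max (f x - average f (right_half a b)) 0) (left_half a b)))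
      = (\<lambda>z. ereal (V z))"
    by (simp add: V_def fun_eq_iff split_beta)
  ultimately have "f \<in> BMO_plus \<longleftrightarrow> locally_integrable f \<and> (\<exists>N. \<forall>z\<in>?P. V z \<le> N)"
    unfolding BMO_plus_def by (simp only: mem_Collect_eq)
  then show ?thesis by (simp add: V_def)
qed

lemma set_integral_constant:
  fixes S :: "real set" and c :: real
  assumes "S \<in> lmeasurable"
  shows "set_integrable lebesgue S (\<lambda>x. c)" and "(LINT x:S|lebesgue. c) = c * measure lebesgue S"
proof -
  have "integrable lebesgue (indicator S :: real \<Rightarrow> real)"
    using assms by (simp add: lmeasurable_iff_integrable)
  then show "set_integrable lebesgue S (\<lambda>x. c)" unfolding set_integrable_def by simp
  show "(LINT x:S|lebesgue. c) = c * measure lebesgue S"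
    unfolding set_lebesgue_integral_def using assms by simp
qed

lemma set_integrable_pos_part:
  fixes f :: "real \<Rightarrow> real"
  assumes "S \<in> lmeasurable" "set_integrable lebesgue S f"
  shows "set_integrable lebesgue S (\<lambda>x. max (f x - c) 0)"
    and "set_integrable lebesgue S (\<lambda>x. max (c - f x) 0)"
proof -
  have *: "set_integrable lebesgue S (\<lambda>x. max (h x) 0)" if "set_integrable lebesgue S h" for h :: "real \<Rightarrow> real"
  proof -
    have "indicator S x *\<^sub>R max (h x) 0 = max (indicator S x *\<^sub>R h x) 0" for x
      by (simp add: indicator_def)
    then show ?thesis using that unfolding set_integrable_def by simp
  qed
  show "set_integrable lebesgue S (\<lambda>x. max (f x - c) 0)"
    by (intro * set_integral_diff(1) assms set_integral_constant(1))
  show "set_integrable lebesgue S (\<lambda>x. max (c - f x) 0)"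
    by (intro * set_integral_diff(1) assms set_integral_constant(1))
qed

lemma set_integral_restrict_AE:
  fixes h :: "real \<Rightarrow> real"
  assumes "set_integrable lebesgue S h" "U \<in> sets lebesgue" "U \<subseteq> S"
    and ae: "AE x in lebesgue. x \<in> S - U \<longrightarrow> h x = 0"
  shows "(LINT x:S|lebesgue. h x) = (LINT x:U|lebesgue. h x)"
  unfolding set_lebesgue_integral_def
proof (rule integral_cong_AE)
  show "(\<lambda>x. indicator S x *\<^sub>R h x) \<in> borel_measurable lebesgue"
    using assms(1) unfolding set_integrable_def by (rule borel_measurable_integrable)
  show "(\<lambda>x. indicator U x *\<^sub>R h x) \<in> borel_measurable lebesgue"
    using set_integrable_subset[OF assms(1-3)] unfolding set_integrable_def
    by (rule borel_measurable_integrable)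
  show "AE x in lebesgue. indicator S x *\<^sub>R h x = indicator U x *\<^sub>R h x"
    using ae by eventually_elim (use assms(3) in \<open>auto simp: indicator_def\<close>)
qed

lemma set_integral_Markov:
  fixes h :: "real \<Rightarrow> real"
  assumes h: "set_integrable lebesgue S h" "\<And>x. x \<in> S \<Longrightarrow> 0 \<le> h x"
    and A: "A \<in> lmeasurable" "A \<subseteq> S" "\<And>x. x \<in> A \<Longrightarrow> l \<le> h x"
  shows "l * measure lebesgue A \<le> (LINT x:S|lebesgue. h x)"
proof -
  have "l * measure lebesgue A = (LINT x:A|lebesgue. l)"
    using A(1) by (simp add: set_integral_constant)
  also have "\<dots> \<le> (LINT x:S|lebesgue. h x)"
    unfolding set_lebesgue_integral_def
  proof (rule integral_mono)
    show "integrable lebesgue (\<lambda>x. indicator A x *\<^sub>R l)"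
      using set_integral_constant(1)[OF A(1)] unfolding set_integrable_def .
    show "integrable lebesgue (\<lambda>x. indicator S x *\<^sub>R h x)"
      using h(1) unfolding set_integrable_def .
    show "indicator A x *\<^sub>R l \<le> indicator S x *\<^sub>R h x" for x
      using A(2,3) h(2) by (auto simp: indicator_def)
  qed
  finally show ?thesis .
qed

text \<open>
  Take \<open>g = \<mu> - f\<close> and \<open>k = N - (f - \<mu>)\<^sup>+\<close>.  If \<open>f\<close> has mean at most \<open>\<mu>\<close> over a right half, then
  \<open>(f - \<mu>)\<^sup>+\<close> is dominated on the left half by the positive part of \<open>f\<close> minus that mean, so its mean is
  at most \<open>N\<close>.  Over \<open>U\<close> the integral of \<open>g\<close> vanishes, which makes the integrals of \<open>(\<mu> - f)\<^sup>+\<close> and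
  \<open>(f - \<mu>)\<^sup>+\<close> equal: a bound on one is a bound on the other.  So the one-sided hypothesis controls
  \<open>(f - \<mu>)\<^sup>+\<close> before \<open>p\<close> and \<open>(\<mu> - f)\<^sup>+\<close> after \<open>p\<close>, and Markov's inequality yields the decay \<open>N / l\<close>.
\<close>
lemma splits_levels_of_BMO_plus:
  fixes f :: "real \<Rightarrow> real"
  assumes f: "f \<in> borel_measurable lebesgue" and "f \<in> BMO_plus"
  obtains N where "0 \<le> N" "splits_levels f (\<lambda>l. N / l)"
proof -
  obtain N0 where loc: "locally_integrable f" and N0: "\<And>a b. a < b \<Longrightarrow>
      average (\<lambda>x. max (f x - average f (right_half a b)) 0) (left_half a b) \<le> N0"
    using \<open>f \<in> BMO_plus\<close> unfolding BMO_plus_iff by blast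
  define N where "N = max N0 0"
  have "0 \<le> N" by (simp add: N_def)
  have fI: "set_integrable lebesgue {c..d} f" for c d
    using loc unfolding locally_integrable_def by blast
  have fO: "set_integrable lebesgue {c<..<d} f" for c d
    by (rule set_integrable_subset[OF fI[of c d]]) auto
  have main: "\<exists>p\<in>{a..b}. \<forall>l>0.
     measure lebesgue {x \<in> {a<..<p}. \<mu> + l < f x} \<le> N / l * (p - a) \<and>
     measure lebesgue {x \<in> {p<..<b}. f x < \<mu> - l} \<le> N / l * (b - p)"
    if ab: "a < b" for a b \<mu>
  proof -
    define g where "g x = \<mu> - f x" for x
    define P where "P x = max (f x - \<mu>) 0" for x
    define Q where "Q x = max (\<mu> - f x) 0" for x
    define k where "k x = N - P x" for x
    have PQ: "Q x = g x + P x" for x by (simp add: P_def Q_def g_def)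
    have gI: "set_integrable lebesgue S g" and PI: "set_integrable lebesgue S P"
      and QI: "set_integrable lebesgue S Q" and kI: "set_integrable lebesgue S k"
      if "S \<in> lmeasurable" "set_integrable lebesgue S f" for S
    proof -
      show "set_integrable lebesgue S g"
        unfolding g_def by (intro set_integral_diff(1) set_integral_constant(1) that)
      show P: "set_integrable lebesgue S P" unfolding P_def by (rule set_integrable_pos_part(1)[OF that])
      show "set_integrable lebesgue S Q" unfolding Q_def by (rule set_integrable_pos_part(2)[OF that])
      show "set_integrable lebesgue S k"
        unfolding k_def by (intro set_integral_diff(1) set_integral_constant(1) that P)
    qed
    have gv: "(LINT x:S|lebesgue. g x) = \<mu> * measure lebesgue S - (LINT x:S|lebesgue. f x)"
      and kv: "(LINT x:S|lebesgue. k x) = N * measure lebesgue S - (LINT x:S|lebesgue. P x)"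
      and Qv: "(LINT x:S|lebesgue. Q x) = (LINT x:S|lebesgue. g x) + (LINT x:S|lebesgue. P x)"
      if "S \<in> lmeasurable" "set_integrable lebesgue S f" for S
    proof -
      show "(LINT x:S|lebesgue. g x) = \<mu> * measure lebesgue S - (LINT x:S|lebesgue. f x)"
        unfolding g_def
        by (simp only: set_integral_diff(2)[OF set_integral_constant(1)[OF that(1)] that(2)] set_integral_constant(2)[OF that(1)])
      show "(LINT x:S|lebesgue. k x) = N * measure lebesgue S - (LINT x:S|lebesgue. P x)"
        unfolding k_def
        by (simp only: set_integral_diff(2)[OF set_integral_constant(1)[OF that(1)] PI[OF that]] set_integral_constant(2)[OF that(1)])
      show "(LINT x:S|lebesgue. Q x) = (LINT x:S|lebesgue. g x) + (LINT x:S|lebesgue. P x)"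
        unfolding PQ by (rule set_integral_add(2)[OF gI[OF that] PI[OF that]])
    qed
    have half: "halving_implies c e g k" for c e
      unfolding halving_implies_def
    proof (intro allI impI, elim conjE)
      fix x d assume "x < d" and pos: "0 \<le> (LINT y:{(x + d) / 2<..<d}|lebesgue. g y)"
      define m where "m = (x + d) / 2"
      have xm: "x < m" "m < d" using \<open>x < d\<close> m_def by simp_all
      have lr: "left_half x d = {x<..<m}" "right_half x d = {m<..<d}"
        unfolding left_half_def right_half_def m_def by (rule refl)+
      define A where "A = average f {m<..<d}"
      have "(LINT y:{m<..<d}|lebesgue. f y) \<le> \<mu> * (d - m)"
        using pos gv[OF _ fO, of m d] xm unfolding m_def[symmetric] by simp
      then have "A \<le> \<mu>" using xm by (simp add: A_def average_def divide_le_eq)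
      have "(LINT y:{x<..<m}|lebesgue. P y) \<le> (LINT y:{x<..<m}|lebesgue. max (f y - A) 0)"
        by (rule set_integral_mono[OF PI[OF _ fO] set_integrable_pos_part(1)[OF _ fO]])
           (use \<open>A \<le> \<mu>\<close> in \<open>auto simp: P_def\<close>)
      also have "\<dots> \<le> N * (m - x)"
      proof -
        have "average (\<lambda>y. max (f y - A) 0) {x<..<m} \<le> N"
          using N0[OF \<open>x < d\<close>] unfolding lr A_def[symmetric] N_def by simp
        then show ?thesis using xm by (simp add: average_def divide_le_eq)
      qed
      finally show "0 \<le> (LINT y:{x<..<(x + d) / 2}|lebesgue. k y)"
        unfolding m_def[symmetric] using kv[OF _ fO, of x m] xm by simp
    qed
    have gIcc: "set_integrable lebesgue {c..d} g" and kIcc: "set_integrable lebesgue {c..d} k" for c d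
      by (rule gI[OF _ fI] kI[OF _ fI], simp)+
    obtain p where p: "a \<le> p" "p \<le> b"
      and prefix: "\<forall>y\<in>{p..b}. (LINT x:{p<..<y}|lebesgue. g x) \<le> 0"
      and suffix: "\<forall>y\<in>{a..p}. 0 \<le> (LINT x:{y<..<p}|lebesgue. g x)"
      by (rule splitting_point[OF gIcc less_imp_le[OF ab]]) auto
    have P_bound: "(LINT x:U|lebesgue. P x) \<le> N * (d - c)"
      if U: "U \<in> sets lebesgue" "U \<subseteq> {c<..<d}" "0 \<le> (LINT x:U|lebesgue. k x)" and "c \<le> d" for U c d
    proof -
      have Ul: "U \<in> lmeasurable" by (rule fmeasurableI2[OF lmeasurable_interval(2) U(2,1)])
      have "measure lebesgue U \<le> measure lebesgue {c<..<d}"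
        by (rule measure_mono_fmeasurable[OF U(2,1)]) simp
      then have "N * measure lebesgue U \<le> N * (d - c)"
        using \<open>0 \<le> N\<close> \<open>c \<le> d\<close> by (intro mult_left_mono) simp_all
      then show ?thesis
        using kv[OF Ul set_integrable_subset[OF fO U(1,2)]] U(3) by linarith
    qed
    have right: "(LINT x:{p<..<b}|lebesgue. Q x) \<le> N * (b - p)"
    proof -
      obtain U where U: "U \<in> sets lebesgue" "U \<subseteq> {p<..<b}"
        "(LINT x:U|lebesgue. g x) = 0" "0 \<le> (LINT x:U|lebesgue. k x)"
        "AE x in lebesgue. x \<in> {p<..<b} - U \<longrightarrow> g x \<le> 0"
        by (rule rising_sun_right[OF gIcc kIcc half prefix])
      have Ul: "U \<in> lmeasurable" by (rule fmeasurableI2[OF lmeasurable_interval(2) U(2,1)])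
      have "(LINT x:{p<..<b}|lebesgue. Q x) = (LINT x:U|lebesgue. Q x)"
      proof (rule set_integral_restrict_AE[OF QI[OF lmeasurable_interval(2) fO] U(1,2)])
        show "AE x in lebesgue. x \<in> {p<..<b} - U \<longrightarrow> Q x = 0"
          using U(5) by eventually_elim (simp add: Q_def g_def)
      qed
      also have "\<dots> = (LINT x:U|lebesgue. P x)"
        using Qv[OF Ul set_integrable_subset[OF fO U(1,2)]] U(3) by simp
      also have "\<dots> \<le> N * (b - p)" by (rule P_bound[OF U(1,2,4) p(2)])
      finally show ?thesis .
    qed
    have left: "(LINT x:{a<..<p}|lebesgue. P x) \<le> N * (p - a)"
    proof -
      obtain U where U: "U \<in> sets lebesgue" "U \<subseteq> {a<..<p}"
        "(LINT x:U|lebesgue. g x) = 0" "0 \<le> (LINT x:U|lebesgue. k x)"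
        "AE x in lebesgue. x \<in> {a<..<p} - U \<longrightarrow> 0 \<le> g x"
        by (rule rising_sun_left[OF gIcc kIcc half suffix])
      have "(LINT x:{a<..<p}|lebesgue. P x) = (LINT x:U|lebesgue. P x)"
      proof (rule set_integral_restrict_AE[OF PI[OF lmeasurable_interval(2) fO] U(1,2)])
        show "AE x in lebesgue. x \<in> {a<..<p} - U \<longrightarrow> P x = 0"
          using U(5) by eventually_elim (simp add: P_def g_def)
      qed
      also have "\<dots> \<le> N * (p - a)" by (rule P_bound[OF U(1,2,4) p(1)])
      finally show ?thesis .
    qed
    have "measure lebesgue {x \<in> {a<..<p}. \<mu> + l < f x} \<le> N / l * (p - a) \<and>
        measure lebesgue {x \<in> {p<..<b}. f x < \<mu> - l} \<le> N / l * (b - p)" if "0 < l" for l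
    proof -
      have "l * measure lebesgue {x \<in> {a<..<p}. \<mu> + l < f x} \<le> (LINT x:{a<..<p}|lebesgue. P x)"
        by (rule set_integral_Markov[OF PI[OF lmeasurable_interval(2) fO] _ level_sets_lmeasurable(2)[OF f]])
           (auto simp: P_def)
      then have 1: "l * measure lebesgue {x \<in> {a<..<p}. \<mu> + l < f x} \<le> N * (p - a)"
        using left by (rule order_trans)
      have "l * measure lebesgue {x \<in> {p<..<b}. f x < \<mu> - l} \<le> (LINT x:{p<..<b}|lebesgue. Q x)"
        by (rule set_integral_Markov[OF QI[OF lmeasurable_interval(2) fO] _ level_sets_lmeasurable(1)[OF f]])
           (auto simp: Q_def)
      then have 2: "l * measure lebesgue {x \<in> {p<..<b}. f x < \<mu> - l} \<le> N * (b - p)"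
        using right by (rule order_trans)
      show ?thesis using 1 2 \<open>0 < l\<close> by (simp add: le_divide_eq mult.commute)
    qed
    then show ?thesis using p by (intro bexI[of _ p] allI impI) simp_all
  qed
  have "splits_levels f (\<lambda>l. N / l)"
    unfolding splits_levels_def by (intro allI impI main)
  then show ?thesis by (rule that[OF \<open>0 \<le> N\<close>])
qed

section \<open>Consequences of splitting points\<close>

text \<open>
  According to whether \<open>p\<close> lies to the right or to the left of the midpoint, the level is almost an
  upper bound on the left half or almost a lower bound on the right half.
\<close>
lemma splits_levels_half:
  fixes f :: "real \<Rightarrow> real"
  assumes f: "f \<in> borel_measurable lebesgue" and sp: "splits_levels f \<phi>" and "a < b"
    and \<phi>: "\<forall>l>0. 0 \<le> \<phi> l"
  shows "(\<forall>l>0. measure lebesgue {x \<in> left_half a b. \<mu> + l < f x} \<le> \<phi> l * (b - a)) \<or>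
         (\<forall>l>0. measure lebesgue {x \<in> right_half a b. f x < \<mu> - l} \<le> \<phi> l * (b - a))"
proof -
  define c where "c = (a + b) / 2"
  have lr: "left_half a b = {a<..<c}" "right_half a b = {c<..<b}"
    unfolding left_half_def right_half_def c_def by (rule refl)+
  obtain p where p: "a \<le> p" "p \<le> b"
    and L: "\<forall>l>0. measure lebesgue {x \<in> {a<..<p}. \<mu> + l < f x} \<le> \<phi> l * (p - a)"
    and R: "\<forall>l>0. measure lebesgue {x \<in> {p<..<b}. f x < \<mu> - l} \<le> \<phi> l * (b - p)"
    using sp[unfolded splits_levels_def, rule_format, OF \<open>a < b\<close>, of \<mu>] by auto
  note m = level_sets_lmeasurable[OF f]
  show ?thesis
  proof (cases "c \<le> p")
    case True
    have "measure lebesgue {x \<in> {a<..<c}. \<mu> + l < f x} \<le> \<phi> l * (b - a)" if "0 < l" for l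
    proof -
      have "measure lebesgue {x \<in> {a<..<c}. \<mu> + l < f x} \<le> measure lebesgue {x \<in> {a<..<p}. \<mu> + l < f x}"
        by (rule measure_mono_fmeasurable[OF _ fmeasurableD[OF m(2)] m(2)]) (use True in auto)
      also have "\<dots> \<le> \<phi> l * (p - a)" using L that by blast
      also have "\<dots> \<le> \<phi> l * (b - a)" using p \<phi> that by (intro mult_left_mono) simp_all
      finally show ?thesis .
    qed
    then show ?thesis unfolding lr by blast
  next
    case False
    have "measure lebesgue {x \<in> {c<..<b}. f x < \<mu> - l} \<le> \<phi> l * (b - a)" if "0 < l" for l
    proof -
      have "measure lebesgue {x \<in> {c<..<b}. f x < \<mu> - l} \<le> measure lebesgue {x \<in> {p<..<b}. f x < \<mu> - l}"
        by (rule measure_mono_fmeasurable[OF _ fmeasurableD[OF m(1)] m(1)]) (use False in auto)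
      also have "\<dots> \<le> \<phi> l * (b - p)" using R that by blast
      also have "\<dots> \<le> \<phi> l * (b - a)" using p \<phi> that by (intro mult_left_mono) simp_all
      finally show ?thesis .
    qed
    then show ?thesis unfolding lr by blast
  qed
qed

lemma measure_above_less_max_median:
  fixes f :: "real \<Rightarrow> real"
  assumes f: "f \<in> borel_measurable lebesgue" and t: "0 < t" "t < 1" and "c < d"
    and m: "m < max_median t f {c<..<d}"
  shows "(1 - t) * (d - c) \<le> measure lebesgue {x \<in> {c<..<d}. m < f x}"
proof -
  obtain m' where m': "m < m'" "m' < max_median t f {c<..<d}" using dense[OF m] by blast
  note fin = level_sets_lmeasurable[OF f]
  have le: "measure lebesgue {x \<in> {c<..<d}. f x < m'} \<le> t * (d - c)"
    by (rule measure_less_max_median[OF f t \<open>c < d\<close> m'(2)])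
  have "measure lebesgue {c<..<d} \<le>
      measure lebesgue ({x \<in> {c<..<d}. f x < m'} \<union> {x \<in> {c<..<d}. m < f x})"
    by (rule measure_mono_fmeasurable[OF _ _ fmeasurable.Un[OF fin(1,2)]]) (use m' in auto)
  also have "\<dots> \<le> measure lebesgue {x \<in> {c<..<d}. f x < m'} + measure lebesgue {x \<in> {c<..<d}. m < f x}"
    by (rule measure_Un_le[OF fmeasurableD[OF fin(1)] fmeasurableD[OF fin(2)]])
  finally have "d - c \<le> measure lebesgue {x \<in> {c<..<d}. f x < m'} + measure lebesgue {x \<in> {c<..<d}. m < f x}"
    using \<open>c < d\<close> by simp
  then show ?thesis using le by (simp add: left_diff_distrib)
qed

text \<open>
  With \<open>\<mu>\<close> midway between two medians that are more than \<open>2 * l\<close> apart, the left half has a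
  substantial part above \<open>\<mu> + l\<close> and the right half a substantial part below \<open>\<mu> - l\<close>, so the level \<open>\<mu>\<close>
  violates both alternatives.
\<close>
lemma median_gap_of_splits_levels:
  fixes f :: "real \<Rightarrow> real"
  assumes f: "f \<in> borel_measurable lebesgue" and sp: "splits_levels f \<phi>"
    and \<phi>: "\<forall>l>0. 0 \<le> \<phi> l"
    and st: "0 < s" "s < 1" "0 < t" "t < 1"
    and l: "0 < l" "2 * \<phi> l < 1 - t" "2 * \<phi> l < s" and "a < b"
  shows "max_median t f (left_half a b) - max_median s f (right_half a b) \<le> 2 * l"
proof (rule ccontr)
  define c where "c = (a + b) / 2"
  have lr: "left_half a b = {a<..<c}" "right_half a b = {c<..<b}"
    unfolding left_half_def right_half_def c_def by (rule refl)+
  have ac: "a < c" "c < b" using \<open>a < b\<close> c_def by simp_all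
  have ba: "b - a = 2 * (c - a)" "b - a = 2 * (b - c)" by (simp_all add: c_def field_simps)
  define \<mu> where "\<mu> = (max_median t f {a<..<c} + max_median s f {c<..<b}) / 2"
  assume "\<not> ?thesis"
  then have "2 * l < max_median t f {a<..<c} - max_median s f {c<..<b}" by (simp add: lr)
  then have T: "\<mu> + l < max_median t f {a<..<c}" and S: "max_median s f {c<..<b} < \<mu> - l"
    unfolding \<mu>_def by (simp_all add: field_simps)
  have big_left: "(1 - t) * (c - a) \<le> measure lebesgue {x \<in> {a<..<c}. \<mu> + l < f x}"
    by (rule measure_above_less_max_median[OF f st(3,4) ac(1) T])
  have big_right: "s * (b - c) < measure lebesgue {x \<in> {c<..<b}. f x < \<mu> - l}"
    by (rule max_median_less_measure[OF f st(1,2) ac(2) S])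
  from splits_levels_half[OF f sp \<open>a < b\<close> \<phi>, of \<mu>] show False
  proof (elim disjE)
    assume "\<forall>l>0. measure lebesgue {x \<in> left_half a b. \<mu> + l < f x} \<le> \<phi> l * (b - a)"
    then have "measure lebesgue {x \<in> {a<..<c}. \<mu> + l < f x} \<le> (2 * \<phi> l) * (c - a)"
      using l(1) unfolding lr ba(1) by (simp add: mult.assoc mult.left_commute)
    also have "\<dots> < (1 - t) * (c - a)" using l(2) ac(1) by (intro mult_strict_right_mono) simp_all
    finally show False using big_left by simp
  next
    assume "\<forall>l>0. measure lebesgue {x \<in> right_half a b. f x < \<mu> - l} \<le> \<phi> l * (b - a)"
    then have "measure lebesgue {x \<in> {c<..<b}. f x < \<mu> - l} \<le> (2 * \<phi> l) * (b - c)"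
      using l(1) unfolding lr ba(2) by (simp add: mult.assoc mult.left_commute)
    also have "\<dots> < s * (b - c)" using l(3) ac(2) by (intro mult_strict_right_mono) simp_all
    finally show False using big_right by simp
  qed
qed

text \<open>
  A discrete layer-cake estimate: \<open>v\<^sup>+\<close> is at most \<open>C\<close> times the number of \<open>j\<close> with \<open>j * C < v\<close>.
\<close>
lemma integral_pos_part_geometric:
  fixes v :: "real \<Rightarrow> real"
  assumes v: "v \<in> borel_measurable lebesgue" and S: "S \<in> lmeasurable"
    and C: "0 < C" and r: "0 \<le> r" "r < 1" and D: "0 \<le> D"
    and lev: "\<And>j. measure lebesgue {x \<in> S. real j * C < v x} \<le> r ^ j * D"
  shows "set_integrable lebesgue S (\<lambda>x. max (v x) 0)"
    and "(LINT x:S|lebesgue. max (v x) 0) \<le> C * D / (1 - r)"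
proof -
  define A where "A j = {x \<in> S. real j * C < v x}" for j
  have A: "A j \<in> lmeasurable" for j
  proof -
    have "{x. real j * C < v x} \<in> sets lebesgue"
      using v borel_measurable_iff_greater[of v lebesgue] by simp
    from fmeasurable_Int_fmeasurable[OF S this] show ?thesis by (simp add: A_def Int_def)
  qed
  define h where "h x = indicator S x *\<^sub>R max (v x) 0" for x
  have hm: "h \<in> borel_measurable lebesgue"
    unfolding h_def using v S by (intro borel_measurable_scaleR borel_measurable_indicator borel_measurable_max) auto
  have h0: "0 \<le> h x" for x by (simp add: h_def indicator_def)
  have bound: "ennreal (h x) \<le> (\<Sum>j. ennreal C * indicator (A j) x)" for x
  proof (cases "x \<in> S \<and> 0 < v x")
    case False
    then have "h x = 0" by (auto simp: h_def indicator_def)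
    then show ?thesis by simp
  next
    case True
    define n where "n = nat \<lceil>v x / C\<rceil>"
    have "v x / C \<le> real n" unfolding n_def by linarith
    then have "v x \<le> real n * C" using C by (simp add: divide_le_eq)
    then have "ennreal (h x) \<le> ennreal (\<Sum>j<n. C)"
      using True by (simp add: h_def ennreal_leI)
    also have "\<dots> = (\<Sum>j<n. ennreal C)" using C by (intro sum_ennreal[symmetric]) simp
    also have "\<dots> = (\<Sum>j<n. ennreal C * indicator (A j) x)"
    proof (rule sum.cong[OF refl])
      fix j assume "j \<in> {..<n}"
      then have "real j < v x / C" unfolding n_def by (simp, linarith)
      then have "real j * C < v x" using C by (simp add: less_divide_eq)
      then have "x \<in> A j" using True by (simp add: A_def)
      then show "ennreal C = ennreal C * indicator (A j) x" by simp
    qed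
    also have "\<dots> \<le> (\<Sum>j. ennreal C * indicator (A j) x)"
      by (intro sum_le_suminf) auto
    finally show ?thesis .
  qed
  have "(\<integral>\<^sup>+x. ennreal (h x) \<partial>lebesgue) \<le> (\<integral>\<^sup>+x. (\<Sum>j. ennreal C * indicator (A j) x) \<partial>lebesgue)"
    by (intro nn_integral_mono bound)
  also have "\<dots> = (\<Sum>j. \<integral>\<^sup>+x. ennreal C * indicator (A j) x \<partial>lebesgue)"
    using fmeasurableD[OF A] by (intro nn_integral_suminf borel_measurable_times_ennreal borel_measurable_indicator) auto
  also have "\<dots> = (\<Sum>j. ennreal C * emeasure lebesgue (A j))"
    using fmeasurableD[OF A] by (simp add: nn_integral_cmult_indicator)
  also have "\<dots> \<le> (\<Sum>j. ennreal (C * D * r ^ j))"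
  proof (intro suminf_le summableI)
    fix j
    have "ennreal C * emeasure lebesgue (A j) = ennreal (C * measure lebesgue (A j))"
      using A C by (simp add: emeasure_eq_measure2 ennreal_mult)
    also have "\<dots> \<le> ennreal (C * (r ^ j * D))"
      using lev[of j] C unfolding A_def by (intro ennreal_leI mult_left_mono) auto
    finally show "ennreal C * emeasure lebesgue (A j) \<le> ennreal (C * D * r ^ j)"
      by (simp add: mult_ac)
  qed
  also have "\<dots> = ennreal (C * D / (1 - r))"
  proof (rule suminf_ennreal_eq)
    show "0 \<le> C * D * r ^ j" for j using C D r by simp
    show "(\<lambda>j. C * D * r ^ j) sums (C * D / (1 - r))"
      using sums_mult[OF geometric_sums[of r], of "C * D"] r by simp
  qed
  finally have nn: "(\<integral>\<^sup>+x. ennreal (h x) \<partial>lebesgue) \<le> ennreal (C * D / (1 - r))" .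
  have "integrable lebesgue h"
  proof (rule integrableI_nonneg[OF hm])
    show "(\<integral>\<^sup>+x. ennreal (h x) \<partial>lebesgue) < \<infinity>"
      using nn by (rule le_less_trans) simp
  qed (simp add: h0)
  then show "set_integrable lebesgue S (\<lambda>x. max (v x) 0)"
    unfolding set_integrable_def h_def .
  have "integral\<^sup>L lebesgue h \<le> C * D / (1 - r)"
    by (rule integral_real_bounded[OF _ nn]) (use C D r in simp)
  then show "(LINT x:S|lebesgue. max (v x) 0) \<le> C * D / (1 - r)"
    unfolding set_lebesgue_integral_def h_def .
qed

text \<open>
  Every level is an approximate upper bound on the left half or an approximate lower bound on the
  right half.  The levels of the first kind form an up-set that is neither empty nor everything,
  as comparison with the medians of the two halves shows, and its infimum \<open>\<theta>\<close> separates the halves: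
  just above \<open>\<theta>\<close> the first alternative holds, just below it the second.
\<close>
lemma separating_level:
  fixes f :: "real \<Rightarrow> real"
  assumes f: "f \<in> borel_measurable lebesgue" and sp: "splits_levels f \<phi>"
    and \<phi>: "\<forall>l>0. 0 \<le> \<phi> l" and l0: "0 < l0" "4 * \<phi> l0 < 1" and "0 < \<delta>" and "a < b"
  obtains \<theta> where
    "\<forall>l>0. measure lebesgue {x \<in> left_half a b. \<theta> + \<delta> + l < f x} \<le> \<phi> l * (b - a)"
    "\<forall>l>0. measure lebesgue {x \<in> right_half a b. f x < \<theta> - \<delta> - l} \<le> \<phi> l * (b - a)"
proof -
  define c where "c = (a + b) / 2"
  have lr: "left_half a b = {a<..<c}" "right_half a b = {c<..<b}"
    unfolding left_half_def right_half_def c_def by (rule refl)+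
  have ac: "a < c" "c < b" using \<open>a < b\<close> c_def by simp_all
  have ba: "b - a = 2 * (c - a)" "b - a = 2 * (b - c)" by (simp_all add: c_def field_simps)
  note fin = level_sets_lmeasurable[OF f]
  define high where "high \<mu> \<longleftrightarrow> (\<forall>l>0. measure lebesgue {x \<in> {a<..<c}. \<mu> + l < f x} \<le> \<phi> l * (b - a))" for \<mu>
  define low where "low \<mu> \<longleftrightarrow> (\<forall>l>0. measure lebesgue {x \<in> {c<..<b}. f x < \<mu> - l} \<le> \<phi> l * (b - a))" for \<mu>
  have alt: "high \<mu> \<or> low \<mu>" for \<mu>
    using splits_levels_half[OF f sp \<open>a < b\<close> \<phi>, of \<mu>] unfolding lr high_def low_def .
  have up: "high \<mu>'" if "high \<mu>" "\<mu> \<le> \<mu>'" for \<mu> \<mu>'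
    unfolding high_def
  proof (intro allI impI)
    fix l :: real assume "0 < l"
    have "measure lebesgue {x \<in> {a<..<c}. \<mu>' + l < f x} \<le> measure lebesgue {x \<in> {a<..<c}. \<mu> + l < f x}"
      by (rule measure_mono_fmeasurable[OF _ fmeasurableD[OF fin(2)] fin(2)]) (use that(2) in auto)
    also have "\<dots> \<le> \<phi> l * (b - a)" using that(1) \<open>0 < l\<close> unfolding high_def by blast
    finally show "measure lebesgue {x \<in> {a<..<c}. \<mu>' + l < f x} \<le> \<phi> l * (b - a)" .
  qed
  have high_bound: "max_median (1/2) f {a<..<c} - l0 \<le> \<mu>" if "high \<mu>" for \<mu>
  proof (rule ccontr)
    assume "\<not> max_median (1/2) f {a<..<c} - l0 \<le> \<mu>"
    then have "\<mu> + l0 < max_median (1/2) f {a<..<c}" by linarith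
    then have "(1 - 1/2) * (c - a) \<le> measure lebesgue {x \<in> {a<..<c}. \<mu> + l0 < f x}"
      by (intro measure_above_less_max_median[OF f _ _ ac(1)]) simp_all
    also have "\<dots> \<le> \<phi> l0 * (b - a)" using that l0(1) unfolding high_def by blast
    also have "\<dots> = (2 * \<phi> l0) * (c - a)" unfolding ba(1) by simp
    also have "\<dots> < (1 - 1/2) * (c - a)" using l0(2) ac(1) by (intro mult_strict_right_mono) simp_all
    finally show False by simp
  qed
  have low_bound: "\<mu> \<le> max_median (1/2) f {c<..<b} + l0" if "low \<mu>" for \<mu>
  proof (rule ccontr)
    assume "\<not> \<mu> \<le> max_median (1/2) f {c<..<b} + l0"
    then have "max_median (1/2) f {c<..<b} < \<mu> - l0" by linarith
    then have "(1/2) * (b - c) < measure lebesgue {x \<in> {c<..<b}. f x < \<mu> - l0}"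
      by (intro max_median_less_measure[OF f _ _ ac(2)]) simp_all
    also have "\<dots> \<le> \<phi> l0 * (b - a)" using that l0(1) unfolding low_def by blast
    also have "\<dots> = (2 * \<phi> l0) * (b - c)" unfolding ba(2) by simp
    also have "\<dots> \<le> (1/2) * (b - c)" using l0(2) ac(2) by (intro mult_right_mono) simp_all
    finally show False by simp
  qed
  have ne: "{\<mu>. high \<mu>} \<noteq> {}"
    using low_bound[of "max_median (1/2) f {c<..<b} + l0 + 1"] alt by fastforce
  have bdd: "bdd_below {\<mu>. high \<mu>}"
    using high_bound by (intro bdd_belowI[of _ "max_median (1/2) f {a<..<c} - l0"]) simp
  define \<theta> where "\<theta> = Inf {\<mu>. high \<mu>}"
  obtain \<mu> where "high \<mu>" "\<mu> < \<theta> + \<delta>"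
    using cInf_lessD[OF ne, of "\<theta> + \<delta>"] \<open>0 < \<delta>\<close> unfolding \<theta>_def[symmetric] by auto
  then have "high (\<theta> + \<delta>)" using up by simp
  moreover have "\<not> high (\<theta> - \<delta>)"
    using cInf_lower[OF _ bdd, of "\<theta> - \<delta>"] \<open>0 < \<delta>\<close> unfolding \<theta>_def[symmetric] by auto
  then have "low (\<theta> - \<delta>)" using alt by blast
  ultimately show ?thesis
    using that[of \<theta>] unfolding lr high_def low_def by blast
qed

text \<open>
  Under exponential decay the level \<open>\<theta>\<close> controls the means of \<open>(f - \<theta>)\<^sup>+\<close> over the left half and of
  \<open>(\<theta> - f)\<^sup>+\<close> over the right half.  The second bound forces the mean of \<open>f\<close> over the right half to be at
  least \<open>\<theta>\<close> up to a constant, and then the first one bounds the oscillation.  Local integrability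
  comes from placing a given interval once as a left half, for the positive part, and once as a
  right half, for the negative part.
\<close>
lemma BMO_plus_of_splits_levels:
  fixes f :: "real \<Rightarrow> real"
  assumes f: "f \<in> borel_measurable lebesgue" and r: "0 < r" "r < 1" and C: "0 < C"
    and sp: "splits_levels f (\<lambda>l. r ^ nat \<lfloor>l / C\<rfloor>)"
  shows "f \<in> BMO_plus"
proof -
  let ?K = "\<lambda>a b. C * (b - a) / (1 - r)"
  have ex: "\<exists>\<theta>. set_integrable lebesgue (left_half a b) (\<lambda>x. max (f x - (\<theta> + C)) 0) \<and>
      (LINT x:left_half a b|lebesgue. max (f x - (\<theta> + C)) 0) \<le> ?K a b \<and>
      set_integrable lebesgue (right_half a b) (\<lambda>x. max ((\<theta> - C) - f x) 0) \<and>
      (LINT x:right_half a b|lebesgue. max ((\<theta> - C) - f x) 0) \<le> ?K a b"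
    if "a < b" for a b
  proof -
    have pos: "\<forall>l>0. 0 \<le> r ^ nat \<lfloor>l / C\<rfloor>" using r by simp
    obtain n where n: "r ^ n < 1 / 4" using real_arch_pow_inv[of "1/4" r] r by auto
    have "r ^ Suc n \<le> r ^ n" using r by (simp add: mult_left_le_one_le)
    then have l0: "0 < real (Suc n) * C" "4 * r ^ nat \<lfloor>real (Suc n) * C / C\<rfloor> < 1"
      using n C by (simp_all del: power_Suc of_nat_Suc)
    obtain \<theta> where
      L: "\<forall>l>0. measure lebesgue {x \<in> left_half a b. \<theta> + C + l < f x} \<le> r ^ nat \<lfloor>l / C\<rfloor> * (b - a)" and
      R: "\<forall>l>0. measure lebesgue {x \<in> right_half a b. f x < \<theta> - C - l} \<le> r ^ nat \<lfloor>l / C\<rfloor> * (b - a)"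
      by (rule separating_level[OF f sp pos l0 C \<open>a < b\<close>])
    have lm: "left_half a b \<in> lmeasurable" "right_half a b \<in> lmeasurable"
      unfolding left_half_def right_half_def by simp_all
    have vm: "(\<lambda>x. f x - (\<theta> + C)) \<in> borel_measurable lebesgue" "(\<lambda>x. (\<theta> - C) - f x) \<in> borel_measurable lebesgue"
      using f by simp_all
    \<comment> \<open>The decay is only known for \<open>l > 0\<close>, so the layer \<open>j = 0\<close> is bounded by the length of the interval.\<close>
    have zero: "measure lebesgue {x \<in> S. P x} \<le> b - a" if "S = left_half a b \<or> S = right_half a b"
      "{x \<in> S. P x} \<in> sets lebesgue" for S P
    proof -
      have "S \<subseteq> {a<..<b}" using that(1) \<open>a < b\<close> unfolding left_half_def right_half_def by auto
      then have "{x \<in> S. P x} \<subseteq> {a<..<b}" by blast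
      then have "measure lebesgue {x \<in> S. P x} \<le> measure lebesgue {a<..<b}"
        using that(2) by (rule measure_mono_fmeasurable) simp
      then show ?thesis using \<open>a < b\<close> by simp
    qed
    have 1: "measure lebesgue {x \<in> left_half a b. real j * C < f x - (\<theta> + C)} \<le> r ^ j * (b - a)" for j
    proof (cases "j = 0")
      case False
      then have "0 < real j * C" using C by simp
      then have "measure lebesgue {x \<in> left_half a b. \<theta> + C + real j * C < f x} \<le> r ^ nat \<lfloor>real j * C / C\<rfloor> * (b - a)"
        using L by blast
      then show ?thesis using C by (simp add: less_diff_eq add.commute)
    next
      case True
      have "{x \<in> left_half a b. real j * C < f x - (\<theta> + C)} \<in> sets lebesgue"
        using fmeasurableD[OF level_sets_lmeasurable(2)[OF f]] unfolding left_half_def less_diff_eq by blast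
      then show ?thesis using zero True by simp
    qed
    have 2: "measure lebesgue {x \<in> right_half a b. real j * C < (\<theta> - C) - f x} \<le> r ^ j * (b - a)" for j
    proof -
      have eq: "real j * C < (\<theta> - C) - f x \<longleftrightarrow> f x < \<theta> - C - real j * C" for x by linarith
      show ?thesis
      proof (cases "j = 0")
        case False
        then have "0 < real j * C" using C by simp
        then have "measure lebesgue {x \<in> right_half a b. f x < \<theta> - C - real j * C} \<le> r ^ nat \<lfloor>real j * C / C\<rfloor> * (b - a)"
          using R by blast
        then show ?thesis unfolding eq using C by simp
      next
        case True
        have "{x \<in> right_half a b. f x < \<theta> - C - real j * C} \<in> sets lebesgue"
          using fmeasurableD[OF level_sets_lmeasurable(1)[OF f]] unfolding right_half_def by blast
        then show ?thesis unfolding eq using zero True by simp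
      qed
    qed
    note geo = integral_pos_part_geometric[OF _ _ C less_imp_le[OF r(1)] r(2)]
    have D: "0 \<le> b - a" using \<open>a < b\<close> by simp
    show ?thesis
      using geo[OF vm(1) lm(1) D 1] geo[OF vm(2) lm(2) D 2] by blast
  qed
  have loc: "set_integrable lebesgue {-R<..<R} f" if "0 < R" for R
  proof -
    have "left_half (-R) (3 * R) = {-R<..<R}" "right_half (-3 * R) R = {-R<..<R}"
      unfolding left_half_def right_half_def by simp_all
    moreover have "- R < 3 * R" "- 3 * R < R" using that by simp_all
    ultimately obtain \<theta>\<^sub>1 \<theta>\<^sub>2 where
      i1: "set_integrable lebesgue {-R<..<R} (\<lambda>x. max (f x - (\<theta>\<^sub>1 + C)) 0)" and
      i2: "set_integrable lebesgue {-R<..<R} (\<lambda>x. max ((\<theta>\<^sub>2 - C) - f x) 0)"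
      using ex[of "- R" "3 * R"] ex[of "- 3 * R" R] by metis
    have c: "set_integrable lebesgue {-R<..<R} (\<lambda>x. \<bar>\<theta>\<^sub>1 + C\<bar> + \<bar>\<theta>\<^sub>2 - C\<bar>)"
      by (rule set_integral_constant(1)) simp
    show ?thesis
    proof (rule set_integrable_bound[OF set_integral_add(1)[OF set_integral_add(1)[OF i1 i2] c]])
      show "set_borel_measurable lebesgue {-R<..<R} f"
        unfolding set_borel_measurable_def using f
        by (intro borel_measurable_scaleR borel_measurable_indicator) auto
      show "AE x in lebesgue. x \<in> {-R<..<R} \<longrightarrow> norm (f x) \<le>
          norm (max (f x - (\<theta>\<^sub>1 + C)) 0 + max ((\<theta>\<^sub>2 - C) - f x) 0 + (\<bar>\<theta>\<^sub>1 + C\<bar> + \<bar>\<theta>\<^sub>2 - C\<bar>))"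
        by (intro AE_I2) (auto simp: max_def)
    qed
  qed
  have "locally_integrable f"
    unfolding locally_integrable_def
  proof (intro allI impI)
    fix K :: "real set" assume K: "compact K"
    then obtain R where R: "0 < R" "\<forall>x\<in>K. norm x < R"
      using compact_imp_bounded bounded_pos_less by blast
    then have "K \<subseteq> {-R<..<R}" by (auto simp: abs_less_iff)
    then show "set_integrable lebesgue K f"
      using set_integrable_subset[OF loc[OF R(1)]] lmeasurable_compact[OF K] by (meson fmeasurableD)
  qed
  then have fI: "set_integrable lebesgue {c<..<d} f" for c d
    using set_integrable_subset[of lebesgue "{c..d}" f "{c<..<d}"] unfolding locally_integrable_def
    by (meson compact_Icc fmeasurableD greaterThanLessThan_subseteq_atLeastAtMost_iff lmeasurable_interval(2) order_refl)
  have "average (\<lambda>x. max (f x - average f (right_half a b)) 0) (left_half a b) \<le> 4 * C / (1 - r) + 2 * C"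
    if "a < b" for a b
  proof -
    define c where "c = (a + b) / 2"
    define h where "h = (b - a) / 2"
    have lr: "left_half a b = {a<..<c}" "right_half a b = {c<..<b}"
      unfolding left_half_def right_half_def c_def by (rule refl)+
    have ac: "a < c" "c < b" using \<open>a < b\<close> c_def by simp_all
    have h: "c - a = h" "b - c = h" "b - a = 2 * h" "0 < h"
      using \<open>a < b\<close> by (simp_all add: c_def h_def field_simps)
    obtain \<theta> where
      i1: "set_integrable lebesgue {a<..<c} (\<lambda>x. max (f x - (\<theta> + C)) 0)" and
      b1: "(LINT x:{a<..<c}|lebesgue. max (f x - (\<theta> + C)) 0) \<le> ?K a b" and
      i2: "set_integrable lebesgue {c<..<b} (\<lambda>x. max ((\<theta> - C) - f x) 0)" and
      b2: "(LINT x:{c<..<b}|lebesgue. max ((\<theta> - C) - f x) 0) \<le> ?K a b"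
      using ex[OF \<open>a < b\<close>] unfolding lr by blast
    define A where "A = average f {c<..<b}"
    define K where "K = 2 * C / (1 - r)"
    have K: "?K a b = K * h" unfolding K_def h(3) by simp
    have cr: "set_integrable lebesgue {c<..<b} (\<lambda>x. \<theta> - C)" by (rule set_integral_constant(1)) simp
    have "(LINT x:{c<..<b}|lebesgue. (\<theta> - C) - f x) \<le> K * h"
      unfolding K[symmetric]
      by (rule order_trans[OF set_integral_mono[OF set_integral_diff(1)[OF cr fI] i2] b2]) simp
    then have "(\<theta> - C) * h - A * h \<le> K * h"
      using ac h by (simp add: set_integral_diff(2)[OF cr fI] set_integral_constant(2) A_def average_def left_diff_distrib)
    then have "((\<theta> - C) - A) * h \<le> K * h" by (simp add: left_diff_distrib)
    then have A: "\<theta> - C - A \<le> K" using h(4) by simp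
    have K0: "0 \<le> K" using C r by (simp add: K_def)
    have mh: "measure lebesgue {a<..<c} = h" using ac h(1) by simp
    have cl: "set_integrable lebesgue {a<..<c} (\<lambda>x. 2 * C + K)" by (rule set_integral_constant(1)) simp
    have "(LINT x:{a<..<c}|lebesgue. max (f x - A) 0) \<le>
        (LINT x:{a<..<c}|lebesgue. max (f x - (\<theta> + C)) 0 + (2 * C + K))"
    proof (rule set_integral_mono[OF set_integrable_pos_part(1)[OF _ fI] set_integral_add(1)[OF i1 cl]])
      show "max (f x - A) 0 \<le> max (f x - (\<theta> + C)) 0 + (2 * C + K)" for x
        using A C K0 by (simp add: max_def)
    qed simp
    also have "\<dots> = (LINT x:{a<..<c}|lebesgue. max (f x - (\<theta> + C)) 0) + (2 * C + K) * h"
      by (simp only: set_integral_add(2)[OF i1 cl] set_integral_constant(2)[OF lmeasurable_interval(2)] mh)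
    also have "\<dots> \<le> K * h + (2 * C + K) * h" using b1 unfolding K by simp
    finally have "(LINT x:{a<..<c}|lebesgue. max (f x - A) 0) \<le> (2 * K + 2 * C) * h"
      by (simp add: algebra_simps)
    then have "average (\<lambda>x. max (f x - A) 0) {a<..<c} \<le> 2 * K + 2 * C"
      unfolding average_def mh using h(4) by (simp add: divide_le_eq)
    then show ?thesis unfolding lr A_def K_def by simp
  qed
  then show ?thesis
    unfolding BMO_plus_iff using \<open>locally_integrable f\<close> by blast
qed

section \<open>Equivalence of the three conditions\<close>

theorem theorem1p6:
  fixes f :: "real \<Rightarrow> real"
  assumes "f \<in> borel_measurable lebesgue"
  defines "A \<equiv> f \<in> BMO_plus"
    and "B \<equiv> \<forall>s t. 0 < s \<and> s < t \<and> t < 1 \<longrightarrow>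
           (\<exists>C>0. \<forall>a b. a < b \<longrightarrow>
             max_median t f (left_half a b) - max_median s f (right_half a b) \<le> C)"
    and "D \<equiv> \<exists>s t C. 0 < s \<and> s < t \<and> t < 1 \<and> C > 0 \<and>
           (\<forall>a b. a < b \<longrightarrow>
             max_median t f (left_half a b) - max_median s f (right_half a b) \<le> C)"
  shows "(A \<longleftrightarrow> B) \<and> (B \<longleftrightarrow> D)"
proof -
  note f = assms(1)
  have "B" if BMO: "A"
    unfolding B_def
  proof (intro allI impI, elim conjE)
    fix s t :: real assume st: "0 < s" "s < t" "t < 1"
    obtain N where N: "0 \<le> N" and sp: "splits_levels f (\<lambda>l. N / l)"
      by (rule splits_levels_of_BMO_plus[OF f BMO[unfolded A_def]])
    define e where "e = min s (1 - t)"
    have e: "0 < e" "e \<le> s" "e \<le> 1 - t" using st by (simp_all add: e_def)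
    \<comment> \<open>Any \<open>l > 2 * N / e\<close> would do.\<close>
    define l where "l = (2 * N + 1) / e"
    have l: "0 < l" using N e by (simp add: l_def)
    have "2 * (N / l) < e" using N e by (simp add: l_def field_simps)
    then have *: "2 * (N / l) < 1 - t" "2 * (N / l) < s" using e by linarith+
    have pos: "\<forall>l>0. 0 \<le> N / l" using N by simp
    have s1: "s < 1" and t0: "0 < t" using st by linarith+
    have "max_median t f (left_half a b) - max_median s f (right_half a b) \<le> 2 * l" if "a < b" for a b
      by (rule median_gap_of_splits_levels[OF f sp pos st(1) s1 t0 st(3) l * that])
    then show "\<exists>C>0. \<forall>a b. a < b \<longrightarrow>
        max_median t f (left_half a b) - max_median s f (right_half a b) \<le> C"
      using l by (intro exI[of _ "2 * l"]) simp
  qed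
  moreover have "D" if "B"
  proof -
    have "\<exists>C>0. \<forall>a b. a < b \<longrightarrow>
        max_median (2/3) f (left_half a b) - max_median (1/3) f (right_half a b) \<le> C"
      using that[unfolded B_def, rule_format, of "1/3" "2/3"] by simp
    then obtain C where "C > 0" "\<forall>a b. a < b \<longrightarrow>
        max_median (2/3) f (left_half a b) - max_median (1/3) f (right_half a b) \<le> C" by blast
    then show ?thesis
      unfolding D_def by (intro exI[of _ "1/3"] exI[of _ "2/3"] exI[of _ C]) simp
  qed
  moreover have "A" if "D"
  proof -
    obtain s t C where st: "0 < s" "s < t" "t < 1" and C: "0 < C" and gap: "\<forall>a b. a < b \<longrightarrow>
        max_median t f (left_half a b) - max_median s f (right_half a b) \<le> C"
      using \<open>D\<close> unfolding D_def by blast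
    obtain r where r: "0 < r" "r < 1" and sp: "splits_levels f (\<lambda>l. r ^ nat \<lfloor>l / (2 * C)\<rfloor>)"
      by (rule splits_levels_of_median_gap[OF f st gap C])
    show ?thesis
      unfolding A_def by (rule BMO_plus_of_splits_levels[OF f r _ sp]) (use C in simp)
  qed
  ultimately show ?thesis by blast
qed

end
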